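(* Let $\mathcal{H}$ be a real Hilbert space with inner product $\langle\cdot,\cdot\rangle$ and norm $\|\cdot\|$. Let $\Phi:\mathcal{H}\to\mathbb{R}$ be a convex $C^1$ function such that $\arg\min\Phi=\{v\in\mathcal{H}:\Phi(v)=\Phi^*\}$ is nonempty, where $\Phi^*=\min_{x\in\mathcal{H}}\Phi(x)$. Let $c>0$, $\alpha\in[0,1)$, $\gamma(t)=\frac{c}{(1+t)^\alpha}$, and $g\in L^1(0,+\infty;\mathcal{H})$. Let $x\in W^{2,1}_{loc}(0,+\infty;\mathcal{H})$ be a solution of $$\ddot x(t)+\gamma(t)\dot x(t)+\nabla\Phi(x(t))=g(t),\quad t\ge 0,$$ and let $W(t)=\frac12\|\dot x(t)\|^2+\Phi(x(t))-\Phi^*$. Assume that $\int_0^{+\infty}(1+t)^\alpha\|g(t)\|\,dt<\infty$. Then $x(t)$ converges weakly in $\mathcal{H}$ as $t\to+\infty$ to some $x^*\in\arg\min\Phi$. Moreover, $W(t)=O\left(\frac{1}{t^{2\alpha}}\right)$ as $t\to+\infty$ and $\int_0^{+\infty}(1+t)^\alpha W(t)\,dt<\infty$.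
   Context: $W^{2,1}_{loc}(0,+\infty;\mathcal{H})$ denotes functions whose first and second (weak) derivatives are locally integrable with values in $\mathcal{H}$; $\dot x,\ddot x$ denote the first and second time derivatives. *)

theory Defs
  imports "HOL-Analysis.Analysis" "HOL-Library.Landau_Symbols"
begin

definition argmin_set :: "('a \<Rightarrow> real) \<Rightarrow> 'a set" where
  "argmin_set \<Phi> = {v. \<forall>y. \<Phi> v \<le> \<Phi> y}"

definition weak_conv_at_top :: "(real \<Rightarrow> 'a::real_inner) \<Rightarrow> 'a \<Rightarrow> bool" where
  "weak_conv_at_top x l \<longleftrightarrow> (\<forall>y. ((\<lambda>t. inner (x t) y) \<longlongrightarrow> inner l y) at_top)"

definition is_C1_gradient :: "('a::real_inner \<Rightarrow> real) \<Rightarrow> ('a \<Rightarrow> 'a) \<Rightarrow> bool" where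
  "is_C1_gradient \<Phi> gradPhi \<longleftrightarrow>
     (\<forall>v. (\<Phi> has_derivative (\<lambda>h. inner (gradPhi v) h)) (at v)) \<and> continuous_on UNIV gradPhi"

end

theory Submission
  imports Defs
begin

text \<open>
  Write \<open>lam t = (1 + t) powr \<alpha>\<close>, let \<open>W\<close> be the energy and let \<open>v\<close> be a minimiser. For a large constant
  \<open>k0\<close>, the functional
  \<open>E = k0 lam\<^sup>2 W + lam \<langle>x', x - v\<rangle> + (c - lam') \<parallel>x - v\<parallel>\<^sup>2 / 2\<close>
  dominates \<open>lam\<^sup>2 W + c \<parallel>x - v\<parallel>\<^sup>2 / 4\<close> and satisfies
  \<open>dE \<le> - lam W / 2 dt + k1 (1 + E) (lam \<parallel>g\<parallel> - lam'') dt\<close> once \<open>lam'\<close> is small, which happens because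
  \<open>\<alpha> < 1\<close>. Since \<open>lam \<parallel>g\<parallel>\<close> and \<open>lam''\<close> are integrable, a Gronwall argument bounds \<open>E\<close>, hence
  \<open>lam\<^sup>2 W\<close> and the integral of \<open>lam W\<close>. Up to convergent terms \<open>lam\<^sup>2 W\<close> and \<open>E\<close> are monotone, so
  \<open>lam\<^sup>2 W\<close> tends to \<open>0\<close> and \<open>\<parallel>x - v\<parallel>\<close> converges for every minimiser \<open>v\<close>. Weak convergence then follows
  from Opial's lemma.
\<close>

section \<open>Opial's lemma\<close>

text \<open>Increments add up, so bisection carries the local estimate to
  \<open>D b - D a \<le> e * (K b - K a)\<close>, and \<open>e\<close> is arbitrary. Testing small
  intervals around each point replaces a sign condition on a derivative; \<open>K\<close> measures
  the admissible error.\<close>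

lemma decreasing_if_locally_small_increase:
  fixes D K :: "real \<Rightarrow> real"
  assumes "a \<le> b"
    and local: "\<And>r e. a \<le> r \<Longrightarrow> r \<le> b \<Longrightarrow> e > 0 \<Longrightarrow>
      \<exists>d>0. \<forall>u v. u \<le> r \<and> r \<le> v \<and> v - u < d \<longrightarrow> D v - D u \<le> e * (K v - K u)"
  shows "D b \<le> D a"
proof -
  have *: "D b - D a \<le> e * (K b - K a)" if "e > 0" for e
    using \<open>a \<le> b\<close>
  proof (induction rule: Bolzano)
    case (trans u v w)
    then show ?case by (simp add: algebra_simps)
  next
    case (local r)
    then show ?case using assms(2)[OF local that] by blast
  qed
  have "D b - D a \<le> 0 + e" if "e > 0" for e
  proof -
    \<comment> \<open>The summand 1 keeps \<open>q\<close> positive when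
      \<open>K b = K a\<close>.\<close>
    define q where "q = \<bar>K b - K a\<bar> + 1"
    have "q > 0" by (simp add: q_def)
    have "D b - D a \<le> e / q * (K b - K a)"
      using *[of "e / q"] that \<open>q > 0\<close> by simp
    also have "\<dots> \<le> e / q * q"
      using that \<open>q > 0\<close> by (intro mult_left_mono) (auto simp: q_def)
    finally show ?thesis using \<open>q > 0\<close> by simp
  qed
  then have "D b - D a \<le> 0" by (rule field_le_epsilon)
  then show ?thesis by simp
qed

lemma has_derivative_fst_comp:
  assumes "(f has_vector_derivative d) (at (fst z))"
  shows "((\<lambda>z. f (fst z)) has_derivative (\<lambda>h. fst h *\<^sub>R d)) (at z)"
  using has_derivative_compose[OF has_derivative_fst[OF has_derivative_ident]
      assms[unfolded has_vector_derivative_def]]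
  by simp

lemma has_derivative_fst_comp_real:
  assumes "(f has_real_derivative d) (at (fst z))"
  shows "((\<lambda>z. f (fst z)) has_derivative (\<lambda>h. fst h * d)) (at z)"
  using has_derivative_fst_comp[OF assms[unfolded has_real_derivative_iff_has_vector_derivative]]
  by simp

text \<open>Along the line through \<open>u\<close> and \<open>v\<close> the function is convex in
  one real variable and lies above its tangent at 0; the claim is this tangent bound at 1.\<close>

lemma convex_on_gradient_inequality:
  fixes \<Phi> :: "'a::real_inner \<Rightarrow> real"
  assumes convex: "convex_on UNIV \<Phi>"
    and deriv: "(\<Phi> has_derivative (\<lambda>h. inner G h)) (at u)"
  shows "\<Phi> u - \<Phi> v \<le> inner G (u - v)"
proof -
  define q where "q s = \<Phi> (u + s *\<^sub>R (v - u))" for s :: real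
  have "convex_on UNIV q"
  proof (rule convex_onI)
    fix t x y :: real assume t: "0 < t" "t < 1"
    have "u + ((1 - t) * x + t * y) *\<^sub>R (v - u)
        = (1 - t) *\<^sub>R (u + x *\<^sub>R (v - u)) + t *\<^sub>R (u + y *\<^sub>R (v - u))"
      by (simp add: algebra_simps)
    then show "q ((1 - t) *\<^sub>R x + t *\<^sub>R y) \<le> (1 - t) * q x + t * q y"
      using convex_onD[OF convex, of t "u + x *\<^sub>R (v - u)" "u + y *\<^sub>R (v - u)"] t
      by (simp add: q_def)
  qed simp
  moreover have "(q has_real_derivative inner G (v - u)) (at 0)"
  proof -
    have "((\<lambda>s. u + s *\<^sub>R (v - u)) has_derivative (\<lambda>s. s *\<^sub>R (v - u))) (at 0)"
      by (auto intro!: derivative_eq_intros)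
    then have "(q has_derivative (\<lambda>s. inner G (s *\<^sub>R (v - u)))) (at 0)"
      unfolding q_def
      by (rule has_derivative_compose) (use deriv in simp)
    then show ?thesis
      by (simp add: has_field_derivative_def mult.commute[of _ "inner G (v - u)"])
  qed
  ultimately have "q 1 - q 0 \<ge> inner G (v - u) * (1 - 0)"
    by (intro convex_on_imp_above_tangent[where A = UNIV]) auto
  then show ?thesis by (simp add: q_def inner_diff_right)
qed

section \<open>Nested bounded closed convex sets\<close>

text \<open>The parallelogram identity, arranged so that points of norm close to \<open>d\<close>
  whose midpoint has norm at least \<open>d\<close> must be close to each other.\<close>

lemma norm_diff_le_if_norm_midpoint_ge:
  fixes u v :: "'a::real_inner"
  assumes "0 \<le> d" "d \<le> norm ((1/2) *\<^sub>R (u + v))"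
  shows "(norm (u - v))\<^sup>2 \<le> 2 * (norm u)\<^sup>2 + 2 * (norm v)\<^sup>2 - 4 * d\<^sup>2"
proof -
  have "d\<^sup>2 \<le> (norm ((1/2) *\<^sub>R (u + v)))\<^sup>2"
    using assms by (intro power_mono) auto
  also have "\<dots> = (norm (u + v))\<^sup>2 / 4"
    by (simp add: power_divide)
  finally show ?thesis
    by (simp add: power2_norm_eq_inner inner_add inner_diff inner_commute)
qed

text \<open>The projection argument of Hilbert space: points of \<open>C n\<close> of nearly minimal
  norm form a Cauchy sequence, because the minimal norms \<open>d n\<close> increase to a finite
  limit and midpoints stay in the larger of two sets. The limit of the points lies in every
  \<open>C n\<close>.\<close>

lemma nested_closed_convex_bounded_Inter_nonempty:
  fixes C :: "nat \<Rightarrow> 'a::{real_inner, complete_space} set"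
  assumes closed: "\<And>n. closed (C n)" and convex: "\<And>n. convex (C n)"
    and ne: "\<And>n. C n \<noteq> {}" and decseq: "\<And>m n. m \<le> n \<Longrightarrow> C n \<subseteq> C m"
    and bdd: "bounded (C 0)"
  shows "(\<Inter>n. C n) \<noteq> {}"
proof -
  define d where "d n = Inf (norm ` C n)" for n
  have bb: "bdd_below (norm ` C n)" for n
    by (intro bdd_belowI2[of _ 0]) auto
  have d_le: "d n \<le> norm w" if "w \<in> C n" for n w
    unfolding d_def using that bb by (intro cINF_lower) auto
  have d_nonneg: "0 \<le> d n" for n
    unfolding d_def using ne by (intro cINF_greatest) auto
  have "incseq d"
    unfolding d_def by (intro monoI cINF_superset_mono) (use ne bb decseq in auto)
  obtain B where B: "\<And>w. w \<in> C 0 \<Longrightarrow> norm w \<le> B"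
    using bdd by (auto simp: bounded_iff)
  have d_B: "d n \<le> B" for n
  proof -
    obtain w where "w \<in> C n" using ne by blast
    then show ?thesis using d_le[of w n] B[of w] decseq[of 0 n] by auto
  qed
  obtain l where l: "d \<longlonglongrightarrow> l" and d_l: "\<And>n. d n \<le> l"
    using incseq_convergent[OF \<open>incseq d\<close>, of B] d_B by blast
  have "\<exists>w\<in>C n. norm w < d n + inverse (real (Suc n))" for n
  proof -
    have "Inf (norm ` C n) < d n + inverse (real (Suc n))"
      by (simp add: d_def)
    then show ?thesis
      using cInf_lessD[of "norm ` C n"] ne by blast
  qed
  then obtain w where w: "\<And>n. w n \<in> C n" "\<And>n. norm (w n) < d n + inverse (real (Suc n))"
    by metis
  \<comment> \<open>The parallelogram bound on \<open>(norm (w n - w m))^2\<close> for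
    \<open>n \<le> m\<close>, with both norms replaced by \<open>l + 1 / (n + 1)\<close>; it
    vanishes in the limit because \<open>d\<close> tends to \<open>l\<close>.\<close>
  define b where "b n = 4 * (l + inverse (real (Suc n)))\<^sup>2 - 4 * (d n)\<^sup>2" for n
  have "b \<longlonglongrightarrow> 4 * (l + 0)\<^sup>2 - 4 * l\<^sup>2"
    unfolding b_def by (intro tendsto_intros LIMSEQ_inverse_real_of_nat l)
  then have b0: "b \<longlonglongrightarrow> 0" by simp
  have dist_w: "(norm (w n - w m))\<^sup>2 \<le> b n" if "n \<le> m" for n m
  proof -
    have "(1/2) *\<^sub>R w n + (1/2) *\<^sub>R w m \<in> C n"
      using w(1) decseq[OF that] by (intro convexD[OF convex]) auto
    then have "d n \<le> norm ((1/2) *\<^sub>R (w n + w m))"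
      by (intro d_le) (simp add: scaleR_add_right)
    from norm_diff_le_if_norm_midpoint_ge[OF d_nonneg this]
    have "(norm (w n - w m))\<^sup>2 \<le> 2 * (norm (w n))\<^sup>2 + 2 * (norm (w m))\<^sup>2 - 4 * (d n)\<^sup>2" .
    moreover have "norm (w n) \<le> l + inverse (real (Suc n))"
      using w(2)[of n] d_l[of n] by simp
    moreover have "norm (w m) \<le> l + inverse (real (Suc n))"
    proof -
      have "inverse (real (Suc m)) \<le> inverse (real (Suc n))"
        using that by (simp add: field_simps)
      then show ?thesis using w(2)[of m] d_l[of m] by linarith
    qed
    ultimately show ?thesis
      using power_mono[of "norm (w n)" "l + inverse (real (Suc n))" 2]
        power_mono[of "norm (w m)" "l + inverse (real (Suc n))" 2]
      unfolding b_def by simp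
  qed
  have "Cauchy w"
  proof (rule CauchyI')
    fix e :: real assume "e > 0"
    then have "\<forall>\<^sub>F n in sequentially. b n < e\<^sup>2"
      by (intro order_tendstoD[OF b0]) simp
    then obtain M where M: "\<And>n. n \<ge> M \<Longrightarrow> b n < e\<^sup>2"
      by (auto simp: eventually_sequentially)
    have "dist (w m) (w n) < e" if "m \<ge> M" "n > m" for m n
    proof -
      have "(norm (w m - w n))\<^sup>2 < e\<^sup>2"
        using dist_w[of m n] M[of m] that by simp
      then show ?thesis
        using \<open>e > 0\<close> by (simp add: dist_norm power2_less_imp_less)
    qed
    then show "\<exists>M. \<forall>m\<ge>M. \<forall>n>m. dist (w m) (w n) < e" by blast
  qed
  then obtain z where z: "w \<longlonglongrightarrow> z"
    using Cauchy_convergent convergent_def by blast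
  have "z \<in> C n" for n
  proof (rule Lim_in_closed_set[OF closed _ _ z])
    show "\<forall>\<^sub>F m in sequentially. w m \<in> C n"
      using w(1) decseq by (intro eventually_sequentiallyI[of n]) blast
  qed simp
  then show ?thesis by blast
qed

section \<open>Tail hulls and weak limits\<close>

text \<open>The predicate \<open>P\<close> selects times, which plays the part of passing to a
  subsequence.\<close>

definition tail_hull :: "(real \<Rightarrow> 'a::real_normed_vector) \<Rightarrow> (real \<Rightarrow> bool) \<Rightarrow> 'a set" where
  "tail_hull x P = (\<Inter>n. closure (convex hull (x ` {t. real n \<le> t \<and> P t})))"

lemma tail_hull_subset:
  assumes "closed C" "convex C" "\<forall>\<^sub>F t in at_top. P t \<longrightarrow> x t \<in> C"
  shows "tail_hull x P \<subseteq> C"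
proof -
  obtain T where T: "\<And>t. t \<ge> T \<Longrightarrow> P t \<Longrightarrow> x t \<in> C"
    using assms(3) by (auto simp: eventually_at_top_linorder)
  obtain n where "T \<le> real n" using real_arch_simple by blast
  then have "x ` {t. real n \<le> t \<and> P t} \<subseteq> C" using T by auto
  then have "closure (convex hull (x ` {t. real n \<le> t \<and> P t})) \<subseteq> C"
    using assms(1,2) by (intro closure_minimal hull_minimal)
  then show ?thesis unfolding tail_hull_def by blast
qed

lemma tail_hull_mono:
  "(\<And>t. P t \<Longrightarrow> Q t) \<Longrightarrow> tail_hull x P \<subseteq> tail_hull x Q"
  unfolding tail_hull_def by (intro INF_mono' closure_mono hull_mono image_mono) auto

lemma tail_hull_nonempty:
  fixes x :: "real \<Rightarrow> 'a::{real_inner, complete_space}"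
  assumes "\<And>t. t \<ge> T \<Longrightarrow> norm (x t) \<le> B" and "\<exists>\<^sub>F t in at_top. P t"
  shows "tail_hull x P \<noteq> {}"
proof -
  obtain k where k: "T \<le> real k" using real_arch_simple by blast
  \<comment> \<open>Starting the tails at \<open>k \<ge> T\<close> puts even the first set into the
    ball of radius \<open>B\<close>, as the bound on \<open>x\<close> starts at
    \<open>T\<close>.\<close>
  define C where "C n = closure (convex hull (x ` {t. real (k + n) \<le> t \<and> P t}))" for n
  have "(\<Inter>n. C n) \<noteq> {}"
  proof (rule nested_closed_convex_bounded_Inter_nonempty)
    fix n
    show "C n \<noteq> {}"
      using assms(2) unfolding C_def frequently_def eventually_at_top_linorder by auto
    show "closed (C n)" "convex (C n)" by (simp_all add: C_def convex_closure)
  next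
    fix m n :: nat assume "m \<le> n"
    then show "C n \<subseteq> C m"
      unfolding C_def by (intro closure_mono hull_mono image_mono) auto
  next
    have "C 0 \<subseteq> cball 0 B"
      unfolding C_def
      by (intro closure_minimal hull_minimal) (use k assms(1) in auto)
    then show "bounded (C 0)" using bounded_subset by blast
  qed
  moreover have "(\<Inter>n. C n) \<subseteq> tail_hull x P"
    unfolding tail_hull_def C_def
    by (intro INF_mono' closure_mono hull_mono image_mono) auto
  ultimately show ?thesis by blast
qed

text \<open>Opial's lemma, with weak cluster points replaced by points common to all closed convex hulls
  of tails, which avoids weak compactness.\<close>

lemma weak_conv_if_tail_hull_subset:
  fixes x :: "real \<Rightarrow> 'a::{real_inner, complete_space}"
  assumes bdd: "\<And>t. t \<ge> T \<Longrightarrow> norm (x t) \<le> B"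
    and sub: "tail_hull x (\<lambda>_. True) \<subseteq> S"
    and lim: "\<And>v. v \<in> S \<Longrightarrow> \<exists>l. ((\<lambda>t. (norm (x t - v))\<^sup>2) \<longlongrightarrow> l) at_top"
  shows "\<exists>xs\<in>S. weak_conv_at_top x xs"
proof -
  let ?H = "tail_hull x (\<lambda>_. True)"
  have "?H \<noteq> {}"
    by (rule tail_hull_nonempty[OF bdd]) auto
  then obtain z where z: "z \<in> ?H" by blast
  \<comment> \<open>The difference of the squared distances to \<open>y\<close> and \<open>z\<close>
    is affine in \<open>x t\<close>, so \<open>inner (y - z) (x t)\<close> has a limit
    \<open>q\<close>. Slabs around \<open>q\<close> are closed, convex and eventually contain
    \<open>x t\<close>; hence the whole hull lies in the hyperplane
    \<open>inner (y - z) w = q\<close>, and comparing \<open>w = y\<close> with \<open>w = z\<close>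
    gives \<open>y = z\<close>.\<close>
  have unique: "y = z" if y: "y \<in> ?H" for y
  proof -
    obtain k l where "((\<lambda>t. (norm (x t - y))\<^sup>2) \<longlongrightarrow> k) at_top"
      "((\<lambda>t. (norm (x t - z))\<^sup>2) \<longlongrightarrow> l) at_top"
      using lim y z sub by (meson subsetD)
    then have "((\<lambda>t. ((norm (x t - z))\<^sup>2 - (norm (x t - y))\<^sup>2 + (norm y)\<^sup>2 - (norm z)\<^sup>2) / 2)
        \<longlongrightarrow> (l - k + (norm y)\<^sup>2 - (norm z)\<^sup>2) / 2) at_top" (is "(_ \<longlongrightarrow> ?q) _")
      by (intro tendsto_intros) auto
    then have "((\<lambda>t. inner (y - z) (x t)) \<longlongrightarrow> ?q) at_top"
      by (rule Lim_transform_eventually)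
        (auto simp: power2_norm_eq_inner inner_diff inner_commute)
    then obtain q where q: "((\<lambda>t. inner (y - z) (x t)) \<longlongrightarrow> q) at_top"
      by blast
    have val: "inner (y - z) w = q" if w: "w \<in> ?H" for w
    proof -
      have "\<bar>inner (y - z) w - q\<bar> \<le> 0 + e" if e: "e > 0" for e
      proof -
        let ?C = "{w. inner (y - z) w \<le> q + e} \<inter> {w. inner (y - z) w \<ge> q - e}"
        have "\<forall>\<^sub>F t in at_top. True \<longrightarrow> x t \<in> ?C"
          using order_tendstoD(1)[OF q, of "q - e"] order_tendstoD(2)[OF q, of "q + e"] e
          by (auto elim: eventually_elim2)
        moreover have "closed ?C" "convex ?C"
          by (auto intro: closed_Int closed_halfspace_le closed_halfspace_ge convex_Int
              convex_halfspace_le convex_halfspace_ge)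
        ultimately have "w \<in> ?C"
          using tail_hull_subset[of ?C "\<lambda>_. True" x] w by blast
        then show ?thesis by auto
      qed
      then have "\<bar>inner (y - z) w - q\<bar> \<le> 0" by (rule field_le_epsilon)
      then show ?thesis by simp
    qed
    have "inner (y - z) (y - z) = 0"
      using val[OF y] val[OF z] by (simp add: inner_diff_right)
    then show ?thesis by simp
  qed
  \<comment> \<open>If the bound failed at arbitrarily late times, the tail hull along those times
    would be nonempty, contained in the singleton \<open>?H\<close>, and also contained in a
    half-space that misses \<open>z\<close>.\<close>
  have half: "\<forall>\<^sub>F t in at_top. inner y (x t) < inner y z + e" if "e > 0" for y e
  proof (rule ccontr)
    assume "\<not> ?thesis"
    then have fr: "\<exists>\<^sub>F t in at_top. inner y (x t) \<ge> inner y z + e"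
      by (simp add: frequently_def not_le)
    have "tail_hull x (\<lambda>t. inner y (x t) \<ge> inner y z + e) \<noteq> {}"
      by (rule tail_hull_nonempty[OF bdd fr])
    then obtain w where w: "w \<in> tail_hull x (\<lambda>t. inner y (x t) \<ge> inner y z + e)"
      by blast
    then have "w \<in> ?H" using tail_hull_mono[of _ "\<lambda>_. True"] by blast
    then have "w = z" by (rule unique)
    moreover have "tail_hull x (\<lambda>t. inner y (x t) \<ge> inner y z + e) \<subseteq> {w. inner y w \<ge> inner y z + e}"
      by (intro tail_hull_subset closed_halfspace_ge convex_halfspace_ge) auto
    ultimately show False using w \<open>e > 0\<close> by auto
  qed
  have "((\<lambda>t. inner (x t) y) \<longlongrightarrow> inner z y) at_top" for y
  proof (rule order_tendstoI)
    fix a assume "a < inner z y"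
    then show "\<forall>\<^sub>F t in at_top. a < inner (x t) y"
      using half[of "inner z y - a" "- y"] by (simp add: inner_commute)
  next
    fix a assume "a > inner z y"
    then show "\<forall>\<^sub>F t in at_top. a > inner (x t) y"
      using half[of "a - inner z y" y] by (simp add: inner_commute)
  qed
  then show ?thesis using z sub by (auto simp: weak_conv_at_top_def)
qed

section \<open>Differential inequalities along the flow\<close>

lemma tendsto_at_top_if_decreasing:
  fixes f :: "real \<Rightarrow> real"
  assumes dec: "\<And>s t. T \<le> s \<Longrightarrow> s \<le> t \<Longrightarrow> f t \<le> f s"
    and bdd: "\<And>t. T \<le> t \<Longrightarrow> B \<le> f t"
  shows "\<exists>l. (f \<longlongrightarrow> l) at_top"
proof -
  define l where "l = Inf (f ` {T..})"
  have bb: "bdd_below (f ` {T..})"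
    using bdd by (intro bdd_belowI2[of _ B]) auto
  have "(f \<longlongrightarrow> l) at_top"
  proof (rule order_tendstoI)
    fix a assume "a < l"
    moreover have "l \<le> f t" if "t \<ge> T" for t
      unfolding l_def using bb that by (intro cINF_lower) auto
    ultimately show "\<forall>\<^sub>F t in at_top. a < f t"
      by (intro eventually_at_top_linorderI[of T]) (meson less_le_trans)
  next
    fix a assume "a > l"
    then obtain s where "s \<ge> T" "f s < a"
      unfolding l_def using cInf_lessD[of "f ` {T..}" a] by auto
    then show "\<forall>\<^sub>F t in at_top. f t < a"
      using dec by (intro eventually_at_top_linorderI[of s]) (meson le_less_trans)
  qed
  then show ?thesis ..
qed

section \<open>The equation in increment form\<close>

text \<open>The second-order equation enters through \<open>x'_increment\<close> alone, which
  mentions neither the acceleration nor the forcing: \<open>N\<close> stands for the accumulated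
  \<open>lam * norm g\<close>, and the damping is \<open>c / lam\<close>. The weight
  \<open>lam\<close> is abstract, with the monotonicity, concavity and growth of
  \<open>(1 + t) powr \<alpha>\<close>. Minimisers appear later as points \<open>v\<close> with
  \<open>\<Phi> v = m\<close>.\<close>

locale damped_inertial_flow =
  fixes \<Phi> :: "'a::{real_inner, complete_space} \<Rightarrow> real" and gradPhi :: "'a \<Rightarrow> 'a"
    and x x' :: "real \<Rightarrow> 'a" and N lam lam' lam'' :: "real \<Rightarrow> real" and c m :: real
  assumes convex: "convex_on UNIV \<Phi>"
    and gradient: "\<And>v. (\<Phi> has_derivative (\<lambda>h. inner (gradPhi v) h)) (at v)"
    and lower: "\<And>y. m \<le> \<Phi> y"
    and c_pos: "c > 0"
    and x_deriv: "\<And>t. t > 0 \<Longrightarrow> (x has_vector_derivative x' t) (at t)"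
    and x'_increment: "\<And>r e. r > 0 \<Longrightarrow> e > 0 \<Longrightarrow>
      \<exists>d>0. \<forall>u v. u \<le> r \<and> r \<le> v \<and> v - u < d \<longrightarrow>
        lam r * norm (x' v - x' u + (v - u) *\<^sub>R ((c / lam r) *\<^sub>R x' r + gradPhi (x r)))
          \<le> (1 + e) * (N v - N u) + e * (v - u)"
    and cont_x: "continuous_on {0..} x" and cont_x': "continuous_on {0..} x'"
    and cont_N: "continuous_on {0..} N"
    and N_mono: "\<And>s t. 0 \<le> s \<Longrightarrow> s \<le> t \<Longrightarrow> N s \<le> N t"
    and N_bounded: "bounded (N ` {0..})"
    and lam_deriv: "\<And>t. t > 0 \<Longrightarrow> (lam has_real_derivative lam' t) (at t)"
    and lam'_deriv: "\<And>t. t > 0 \<Longrightarrow> (lam' has_real_derivative lam'' t) (at t)"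
    and cont_lam: "continuous_on {0..} lam"
    and lam_ge_1: "\<And>t. t \<ge> 0 \<Longrightarrow> 1 \<le> lam t" and lam_le: "\<And>t. t \<ge> 0 \<Longrightarrow> lam t \<le> 1 + t"
    and lam'_nonneg: "\<And>t. t > 0 \<Longrightarrow> 0 \<le> lam' t" and lam'_le_1: "\<And>t. t > 0 \<Longrightarrow> lam' t \<le> 1"
    and lam''_nonpos: "\<And>t. t > 0 \<Longrightarrow> lam'' t \<le> 0"
    and lam'_tendsto_0: "(lam' \<longlongrightarrow> 0) at_top"
begin

definition drift :: "real \<Rightarrow> 'a" where
  "drift r = (c / lam r) *\<^sub>R x' r + gradPhi (x r)"

text \<open>The forcing is only integrable, so the velocity need not be differentiable. Functionals of the
  flow are therefore functions \<open>\<psi>\<close> of time, velocity and accumulated forcing along the curve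
  \<open>t \<mapsto> (t, x' t, N t)\<close>, whose increments lie asymptotically in the cone
  \<open>{(\<tau>, \<eta> - \<tau> drift, s) | \<tau> \<ge> 0, lam \<parallel>\<eta>\<parallel> \<le> s}\<close>.\<close>

lemma decreasing_along_flow:
  fixes \<psi> :: "real \<times> 'a \<times> real \<Rightarrow> real"
  assumes "0 < a" "a \<le> b"
    and \<psi>: "\<And>r. a \<le> r \<Longrightarrow> r \<le> b \<Longrightarrow> \<exists>L. (\<psi> has_derivative L) (at (r, x' r, N r)) \<and>
      (\<forall>\<tau> \<eta> s. 0 \<le> \<tau> \<longrightarrow> lam r * norm \<eta> \<le> s \<longrightarrow> L (\<tau>, \<eta> - \<tau> *\<^sub>R drift r, s) \<le> 0)"
  shows "\<psi> (b, x' b, N b) \<le> \<psi> (a, x' a, N a)"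
proof -
  define z where "z t = (t, x' t, N t)" for t
  \<comment> \<open>Increments of the curve \<open>z\<close> are at most a constant times those of
    \<open>K\<close>, so first-order errors can be measured by \<open>K\<close>.\<close>
  define K where "K t = N t + t" for t
  have "\<psi> (z b) \<le> \<psi> (z a)"
  proof (rule decreasing_if_locally_small_increase[OF \<open>a \<le> b\<close>, where K = K])
    fix r e :: real
    assume r: "a \<le> r" "r \<le> b" and "e > 0"
    then have "r > 0" using \<open>0 < a\<close> by simp
    obtain L where L: "(\<psi> has_derivative L) (at (z r))"
      and cone: "\<And>\<tau> \<eta> s. 0 \<le> \<tau> \<Longrightarrow> lam r * norm \<eta> \<le> s \<Longrightarrow> L (\<tau>, \<eta> - \<tau> *\<^sub>R drift r, s) \<le> 0"
      using \<psi>[OF r] unfolding z_def by blast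
    interpret L: bounded_linear L using L by (rule has_derivative_bounded_linear)
    obtain k where "k > 0" and k: "\<And>w. norm (L w) \<le> norm w * k"
      using L.pos_bounded by blast
    \<comment> \<open>The estimate \<open>d3\<close> gives the velocity increment at most
      \<open>2 * (N v - N u) + (1 + norm (drift r)) * (v - u)\<close>; adding the time and forcing
      components leaves coefficients at most \<open>B\<close>.\<close>
    define B where "B = 3 + norm (drift r)"
    have "B > 0" by (simp add: B_def add_pos_nonneg)
    \<comment> \<open>One half of \<open>e\<close> pays for the linearisation error of
      \<open>\<psi>\<close>, the other half for the distance of the increment of \<open>z\<close>
      from the cone.\<close>
    define e1 where "e1 = e / (2 * B)"
    define e2 where "e2 = e / (2 * k)"
    have "e1 > 0" "e2 > 0" using \<open>e > 0\<close> \<open>B > 0\<close> \<open>k > 0\<close> by (simp_all add: e1_def e2_def)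
    obtain d1 where "d1 > 0" and d1: "\<And>y. norm (y - z r) < d1 \<Longrightarrow>
        norm (\<psi> y - \<psi> (z r) - L (y - z r)) \<le> e1 * norm (y - z r)"
      using L \<open>e1 > 0\<close> unfolding has_derivative_at_alt by blast
    have "isCont x' r" "isCont N r"
      using cont_x' cont_N \<open>r > 0\<close>
      by (auto intro!: continuous_on_interior[of "{0..}"])
    then have "isCont z r"
      unfolding z_def by (intro continuous_intros)
    then obtain d2 where "d2 > 0" and d2: "\<And>t. dist t r < d2 \<Longrightarrow> dist (z t) (z r) < d1"
      unfolding continuous_at_eps_delta using \<open>d1 > 0\<close> by blast
    obtain d3 where "d3 > 0" and d3: "\<And>u v. u \<le> r \<Longrightarrow> r \<le> v \<Longrightarrow> v - u < d3 \<Longrightarrow>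
        lam r * norm (x' v - x' u + (v - u) *\<^sub>R drift r) \<le> (1 + 1) * (N v - N u) + 1 * (v - u)"
      using x'_increment[OF \<open>r > 0\<close>, of 1] unfolding drift_def by auto
    obtain d4 where "d4 > 0" and d4: "\<And>u v. u \<le> r \<Longrightarrow> r \<le> v \<Longrightarrow> v - u < d4 \<Longrightarrow>
        lam r * norm (x' v - x' u + (v - u) *\<^sub>R drift r) \<le> (1 + e2) * (N v - N u) + e2 * (v - u)"
      using x'_increment[OF \<open>r > 0\<close> \<open>e2 > 0\<close>] unfolding drift_def by auto
    define d where "d = Min {d2, d3, d4, r}"
    have "d > 0" and d: "d \<le> d2" "d \<le> d3" "d \<le> d4" "d \<le> r"
      using \<open>d2 > 0\<close> \<open>d3 > 0\<close> \<open>d4 > 0\<close> \<open>r > 0\<close> by (auto simp: d_def)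
    have z_le: "norm (z v - z u) \<le> B * (K v - K u)" if uv: "u \<le> r" "r \<le> v" "v - u < d" for u v
    proof -
      have "u \<ge> 0" using uv d by simp
      then have N: "N u \<le> N v" using uv by (intro N_mono) auto
      have "norm (x' v - x' u) \<le> norm (x' v - x' u + (v - u) *\<^sub>R drift r) + norm ((v - u) *\<^sub>R drift r)"
        by (metis add_diff_cancel norm_triangle_ineq4)
      also have "norm (x' v - x' u + (v - u) *\<^sub>R drift r)
          \<le> lam r * norm (x' v - x' u + (v - u) *\<^sub>R drift r)"
        using lam_ge_1[of r] \<open>r > 0\<close> by (simp add: mult_le_cancel_right1)
      also have "\<dots> \<le> 2 * (N v - N u) + (v - u)" using d3[of u v] uv d by simp
      finally have "norm (x' v - x' u) \<le> 2 * (N v - N u) + (v - u) + (v - u) * norm (drift r)"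
        using uv by simp
      moreover have "norm (z v - z u) \<le> \<bar>v - u\<bar> + (norm (x' v - x' u) + \<bar>N v - N u\<bar>)"
        using norm_Pair_le[of "v - u" "(x' v - x' u, N v - N u)"]
          norm_Pair_le[of "x' v - x' u" "N v - N u"] by (simp add: z_def)
      moreover have "0 \<le> norm (drift r) * (N v - N u)" using N by simp
      ultimately show ?thesis
        unfolding B_def K_def using N uv by (simp add: algebra_simps)
    qed
    have L_le: "L (z v - z u) \<le> e / 2 * (K v - K u)" if uv: "u \<le> r" "r \<le> v" "v - u < d" for u v
    proof -
      define \<eta> where "\<eta> = x' v - x' u + (v - u) *\<^sub>R drift r"
      define s where "s = (1 + e2) * (N v - N u) + e2 * (v - u)"
      have "L (v - u, \<eta> - (v - u) *\<^sub>R drift r, s) \<le> 0"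
        using d4[of u v] uv d by (intro cone) (auto simp: \<eta>_def s_def)
      \<comment> \<open>The increment is a cone vector up to an excess in the forcing slot, and that
        excess is exactly \<open>e2 * (K v - K u)\<close>.\<close>
      moreover have "z v - z u = (v - u, \<eta> - (v - u) *\<^sub>R drift r, s) - (0, 0, e2 * (K v - K u))"
        by (simp add: z_def \<eta>_def s_def K_def algebra_simps)
      then have "L (z v - z u)
          = L (v - u, \<eta> - (v - u) *\<^sub>R drift r, s) - L (0, 0, e2 * (K v - K u))"
        by (simp only: L.diff)
      ultimately have "L (z v - z u) \<le> - L (0, 0, e2 * (K v - K u))"
        by linarith
      also have "\<dots> \<le> \<bar>e2 * (K v - K u)\<bar> * k"
        using k[of "(0, 0, e2 * (K v - K u))"] by (simp add: norm_Pair)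
      also have "K v - K u \<ge> 0"
        using N_mono[of u v] uv d by (simp add: K_def)
      then have "\<bar>e2 * (K v - K u)\<bar> * k = e / 2 * (K v - K u)"
        using \<open>e2 > 0\<close> \<open>k > 0\<close> by (simp add: abs_mult) (simp add: e2_def)
      finally show ?thesis .
    qed
    have "\<psi> (z v) - \<psi> (z u) \<le> e * (K v - K u)" if uv: "u \<le> r" "r \<le> v" "v - u < d" for u v
    proof -
      have eB: "e1 * (B * w) = e / 2 * w" for w
        using \<open>B > 0\<close> by (simp add: e1_def)
      have "norm (\<psi> (z v) - \<psi> (z r) - L (z v - z r)) \<le> e1 * norm (z v - z r)"
        using d2[of v] uv d by (intro d1) (simp add: dist_norm)
      moreover have "e1 * norm (z v - z r) \<le> e / 2 * (K v - K r)"
        using mult_left_mono[OF z_le[of r v], of e1] uv \<open>e1 > 0\<close> eB by simp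
      moreover have "norm (\<psi> (z u) - \<psi> (z r) - L (z u - z r)) \<le> e1 * norm (z u - z r)"
        using d2[of u] uv d by (intro d1) (simp add: dist_norm)
      moreover have "e1 * norm (z u - z r) \<le> e / 2 * (K r - K u)"
        using mult_left_mono[OF z_le[of u r], of e1] uv \<open>e1 > 0\<close> eB by (simp add: norm_minus_commute)
      moreover have "L (z v - z u) = L (z v - z r) - L (z u - z r)"
        by (simp add: L.diff)
      ultimately show ?thesis
        using L_le[OF uv] by (simp add: algebra_simps)
    qed
    then show "\<exists>d>0. \<forall>u v. u \<le> r \<and> r \<le> v \<and> v - u < d \<longrightarrow> \<psi> (z v) - \<psi> (z u) \<le> e * (K v - K u)"
      using \<open>d > 0\<close> by blast
  qed
  then show ?thesis by (simp add: z_def)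
qed

section \<open>Energy and Lyapunov functional\<close>

text \<open>The velocity is a separate argument \<open>p\<close>, which makes the energy
  differentiable in time and velocity jointly although \<open>x'\<close> itself may be
  rough.\<close>

definition energy :: "real \<Rightarrow> 'a \<Rightarrow> real" where
  "energy t p = inner p p / 2 + \<Phi> (x t) - m"

abbreviation W :: "real \<Rightarrow> real" where
  "W t \<equiv> energy t (x' t)"

definition I :: "real \<Rightarrow> real" where
  "I t = integral {0..t} (\<lambda>s. lam s * W s)"

text \<open>The part \<open>4 / c\<close> absorbs the cross term of \<open>lyap\<close> and,
  multiplied by \<open>c\<close>, dominates its kinetic contribution to the rate; the summand 1
  leaves one full \<open>lam^2 * W\<close> in the lower bound.\<close>

definition k0 :: real where "k0 = 4 / c + 1"

text \<open>A common factor of \<open>1 + lyap\<close> that bounds both the coefficient of the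
  forcing and the term in \<open>lam''\<close>.\<close>

definition k1 :: real where "k1 = k0 + 1 + 2 / c"

text \<open>The coefficient \<open>c - lam' t\<close> is forced by cancellation: differentiating the
  cross term produces \<open>(lam' - c) * inner p (x - v)\<close>, since \<open>lam\<close> times
  the damping \<open>c / lam\<close> is \<open>c\<close>. What remains of the last summand is the
  term in \<open>- lam''\<close>.\<close>

definition lyap :: "'a \<Rightarrow> real \<Rightarrow> 'a \<Rightarrow> real" where
  "lyap v t p = k0 * ((lam t)\<^sup>2 * energy t p) + lam t * inner p (x t - v)
     + (c - lam' t) * (inner (x t - v) (x t - v) / 2)"

lemma energy_nonneg: "0 \<le> energy t p" and half_norm_le_energy: "(norm p)\<^sup>2 / 2 \<le> energy t p"
proof -
  show "(norm p)\<^sup>2 / 2 \<le> energy t p"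
    using lower[of "x t"] by (simp add: energy_def power2_norm_eq_inner)
  then show "0 \<le> energy t p"
    by (rule order_trans[rotated]) simp
qed

lemma k0_pos: "k0 > 0" and k1_pos: "k1 > 0"
  using c_pos by (auto simp: k0_def k1_def add_pos_pos)

lemma cont_W: "continuous_on {0..} W"
proof -
  have "continuous_on UNIV \<Phi>"
    using gradient by (auto simp: continuous_on_eq_continuous_within intro: has_derivative_continuous)
  then have "continuous_on {0..} (\<lambda>t. \<Phi> (x t))"
    using continuous_on_compose2[OF _ cont_x] by blast
  then show ?thesis
    unfolding energy_def by (intro continuous_intros cont_x')  auto
qed

lemma cont_lam_W: "continuous_on {0..} (\<lambda>t. lam t * W t)"
  by (intro continuous_intros cont_lam cont_W)

lemma lam_W_nonneg: "t \<ge> 0 \<Longrightarrow> 0 \<le> lam t * W t"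
  using lam_ge_1[of t] energy_nonneg by simp

lemma integrable_lam_W: "(\<lambda>t. lam t * W t) integrable_on {0..t}"
  by (intro integrable_continuous_real continuous_on_subset[OF cont_lam_W]) auto

lemma I_nonneg: "0 \<le> I t"
  unfolding I_def by (intro integral_nonneg integrable_lam_W lam_W_nonneg) auto

lemma I_mono: "s \<le> t \<Longrightarrow> I s \<le> I t"
  unfolding I_def by (intro integral_subset_le integrable_lam_W) (auto simp: lam_W_nonneg)

lemma I_deriv:
  assumes "t > 0"
  shows "(I has_real_derivative lam t * W t) (at t)"
proof -
  have "(I has_real_derivative lam t * W t) (at t within {0..t + 1})"
    unfolding I_def using assms
    by (intro integral_has_real_derivative continuous_on_subset[OF cont_lam_W]) auto
  moreover have "t \<in> interior {0..t + 1}" using assms by simp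
  ultimately show ?thesis by (metis at_within_interior)
qed

lemma energy_has_derivative:
  assumes "r > 0"
  shows "((\<lambda>z. energy (fst z) (fst (snd z))) has_derivative
    (\<lambda>h. inner p (fst (snd h)) + fst h * inner (gradPhi (x r)) (x' r))) (at (r, p, q))"
proof -
  have "((\<lambda>z. \<Phi> (x (fst z))) has_derivative (\<lambda>h. inner (gradPhi (x r)) (fst h *\<^sub>R x' r))) (at (r, p, q))"
    using has_derivative_compose[OF has_derivative_fst_comp[OF x_deriv] gradient, of "(r, p, q)"] assms
    by simp
  then show ?thesis
    unfolding energy_def
    by (auto intro!: derivative_eq_intros simp: inner_commute)
qed

text \<open>The potential gradient cancels, leaving the power of the forcing minus friction.\<close>

lemma energy_derivative_cone:
  "inner (x' r) (\<eta> - \<tau> *\<^sub>R drift r) + \<tau> * inner (gradPhi (x r)) (x' r)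
    = inner (x' r) \<eta> - c / lam r * (\<tau> * inner (x' r) (x' r))"
  by (simp add: drift_def algebra_simps inner_commute)

lemma lyap_has_derivative:
  assumes "r > 0"
  shows "((\<lambda>z. lyap v (fst z) (fst (snd z))) has_derivative
    (\<lambda>h. k0 * (2 * lam r * lam' r * fst h * energy r p
           + (lam r)\<^sup>2 * (inner p (fst (snd h)) + fst h * inner (gradPhi (x r)) (x' r)))
       + (fst h * lam' r * inner p (x r - v)
           + lam r * (inner (fst (snd h)) (x r - v) + fst h * inner p (x' r)))
       + ((c - lam' r) * (fst h * inner (x r - v) (x' r))
           - fst h * lam'' r * (inner (x r - v) (x r - v) / 2)))) (at (r, p, q))"
proof -
  let ?z = "(r, p, q)"
  have lam: "((\<lambda>z. lam (fst z)) has_derivative (\<lambda>h. fst h * lam' r)) (at ?z)"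
    and lam': "((\<lambda>z. lam' (fst z)) has_derivative (\<lambda>h. fst h * lam'' r)) (at ?z)"
    using lam_deriv lam'_deriv assms by (auto intro!: has_derivative_fst_comp_real)
  have lam2: "((\<lambda>z. (lam (fst z))\<^sup>2) has_derivative (\<lambda>h. 2 * lam r * lam' r * fst h)) (at ?z)"
    using has_derivative_power[OF lam, of 2] by (simp add: ac_simps)
  have y: "((\<lambda>z. x (fst z) - v) has_derivative (\<lambda>h. fst h *\<^sub>R x' r)) (at ?z)"
    using has_derivative_diff[OF has_derivative_fst_comp has_derivative_const, of x "x' r" ?z v]
      x_deriv[OF assms] by simp
  have p: "((\<lambda>z. fst (snd z)) has_derivative (\<lambda>h. fst (snd h))) (at ?z)"
    by (intro derivative_intros)
  have py: "((\<lambda>z. inner (fst (snd z)) (x (fst z) - v)) has_derivative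
      (\<lambda>h. inner (fst (snd h)) (x r - v) + fst h * inner p (x' r))) (at ?z)"
    using has_derivative_inner[OF p y] by (simp add: add.commute)
  have yy: "((\<lambda>z. inner (x (fst z) - v) (x (fst z) - v) / 2) has_derivative
      (\<lambda>h. fst h * inner (x r - v) (x' r))) (at ?z)"
    using has_derivative_mult_right[OF has_derivative_inner[OF y y], of "1 / 2"]
    by (simp add: inner_commute)
  have c: "((\<lambda>z. c - lam' (fst z)) has_derivative (\<lambda>h. - (fst h * lam'' r))) (at ?z)"
    using has_derivative_diff[OF has_derivative_const lam'] by simp
  define w where "w = x r - v"
  show ?thesis
    unfolding lyap_def
    using has_derivative_add[OF has_derivative_add[OF
          has_derivative_mult_right[OF has_derivative_mult[OF lam2 energy_has_derivative[OF assms]], of k0]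
          has_derivative_mult[OF lam py]] has_derivative_mult[OF c yy]]
    by (rule has_derivative_eq_rhs) (simp add: fun_eq_iff w_def[symmetric] algebra_simps)
qed

text \<open>Young's inequality bounds the cross term by \<open>2 / c * a^2 + c / 8 * b^2\<close>.
  The first summand is paid by the \<open>4 / c\<close> in \<open>k0\<close>; the second is taken
  from the \<open>3 * c / 8 * b^2\<close> that a small \<open>lam'\<close> leaves, so
  \<open>c / 4 * b^2\<close> survives.\<close>

lemma lyap_lower:
  assumes "lam' t \<le> c / 4"
  shows "(lam t)\<^sup>2 * energy t p + c / 4 * (norm (x t - v))\<^sup>2 \<le> lyap v t p"
proof -
  define a where "a = norm (lam t *\<^sub>R p)"
  define b where "b = norm (x t - v)"
  have "a\<^sup>2 / 2 = (lam t)\<^sup>2 * (inner p p / 2)"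
    by (simp add: a_def power_mult_distrib power2_norm_eq_inner)
  also have "\<dots> \<le> (lam t)\<^sup>2 * energy t p"
    using lower[of "x t"] by (intro mult_left_mono) (auto simp: energy_def)
  finally have a: "a\<^sup>2 / 2 \<le> (lam t)\<^sup>2 * energy t p" .
  have "- (a * b) \<le> lam t * inner p (x t - v)"
    using Cauchy_Schwarz_ineq2[of "lam t *\<^sub>R p" "x t - v"] by (simp add: a_def b_def abs_le_iff)
  moreover have "a * b \<le> 2 / c * a\<^sup>2 + c / 8 * b\<^sup>2"
  proof -
    have "0 \<le> 2 / c * (a - c / 4 * b)\<^sup>2" using c_pos by simp
    then show ?thesis
      using c_pos by (simp add: power2_diff power_mult_distrib field_simps power2_eq_square)
  qed
  moreover have "2 / c * a\<^sup>2 \<le> 4 / c * ((lam t)\<^sup>2 * energy t p)"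
    using mult_left_mono[OF a, of "4 / c"] c_pos by simp
  moreover have "3 * c / 8 * b\<^sup>2 \<le> (c - lam' t) * (b\<^sup>2 / 2)"
    using mult_right_mono[of "3 * c / 4" "c - lam' t" "b\<^sup>2 / 2"] assms by simp
  moreover have "lyap v t p = 4 / c * ((lam t)\<^sup>2 * energy t p) + (lam t)\<^sup>2 * energy t p
      + lam t * inner p (x t - v) + (c - lam' t) * (b\<^sup>2 / 2)"
    unfolding lyap_def k0_def b_def power2_norm_eq_inner by (simp only: distrib_right mult_1)
  moreover have "c / 4 * b\<^sup>2 + c / 8 * b\<^sup>2 = 3 * c / 8 * b\<^sup>2" by simp
  ultimately show ?thesis unfolding b_def[symmetric] by linarith
qed

lemma lyap_nonneg:
  assumes "lam' t \<le> c / 4"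
  shows "0 \<le> lyap v t p"
proof -
  have "0 \<le> (lam t)\<^sup>2 * energy t p + c / 4 * (norm (x t - v))\<^sup>2"
    using energy_nonneg c_pos by simp
  then show ?thesis using lyap_lower[OF assms, of p v] by linarith
qed

text \<open>The differential on a cone direction splits into dissipation (multiples of
  \<open>\<tau>\<close>), forcing (terms in \<open>\<eta>\<close>) and curvature (the term in
  \<open>lam''\<close>), each estimated separately. Forcing and curvature combine into a Gronwall
  rate acting on \<open>1 + lyap\<close>.\<close>

lemma lyap_rate:
  assumes "r > 0" and small: "lam' r \<le> c / 4" "k0 * lam' r \<le> 1 / 4" and v: "\<Phi> v = m"
  obtains L where "((\<lambda>z. lyap v (fst z) (fst (snd z))) has_derivative L) (at (r, x' r, N r))"
    and "\<And>\<tau> \<eta> s. 0 \<le> \<tau> \<Longrightarrow> lam r * norm \<eta> \<le> s \<Longrightarrow>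
      L (\<tau>, \<eta> - \<tau> *\<^sub>R drift r, s)
        \<le> - (\<tau> * (lam r * W r) / 2) + k1 * (1 + lyap v r (x' r)) * (s - lam'' r * \<tau>)"
proof (rule that[OF lyap_has_derivative[OF \<open>r > 0\<close>]])
  fix \<tau> s :: real and \<eta> :: 'a
  assume "0 \<le> \<tau>" and s: "lam r * norm \<eta> \<le> s"
  define E where "E = lyap v r (x' r)"
  define A where "A = inner (x' r) (x' r)"
  define y where "y = x r - v"
  define G where "G = inner (gradPhi (x r)) y"
  have lam: "lam r \<ge> 1" using lam_ge_1 \<open>r > 0\<close> by simp
  have G: "W r - A / 2 \<le> G"
    using convex_on_gradient_inequality[OF convex gradient, of "x r" v] v
    by (simp add: energy_def A_def G_def y_def)
  have E: "(lam r)\<^sup>2 * W r + c / 4 * (norm y)\<^sup>2 \<le> E"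
    unfolding E_def y_def by (rule lyap_lower[OF small(1)])
  have "0 \<le> (lam r)\<^sup>2 * W r" using energy_nonneg by simp
  have "0 \<le> c / 4 * (norm y)\<^sup>2" using c_pos by simp
  \<comment> \<open>The bound \<open>q \<le> 1 / 2 + q^2 / 2\<close> turns first powers of velocity
    and position into quantities controlled by \<open>1 + E\<close>, as Gronwall requires.\<close>
  have "lam r * norm (x' r) \<le> 1 / 2 + E"
  proof -
    have "lam r * norm (x' r) \<le> 1 / 2 + (lam r * norm (x' r))\<^sup>2 / 2"
      using zero_le_power2[of "lam r * norm (x' r) - 1"] by (simp add: power2_diff)
    also have "(lam r * norm (x' r))\<^sup>2 / 2 \<le> (lam r)\<^sup>2 * W r"
      using mult_left_mono[OF half_norm_le_energy[of "x' r" r], of "(lam r)\<^sup>2"]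
      by (simp add: power_mult_distrib)
    finally show ?thesis using E \<open>0 \<le> c / 4 * (norm y)\<^sup>2\<close> by linarith
  qed
  have y2: "(norm y)\<^sup>2 / 2 \<le> 2 / c * E"
    using E \<open>0 \<le> (lam r)\<^sup>2 * W r\<close> c_pos by (simp add: field_simps)
  have y1: "norm y \<le> 1 / 2 + 2 / c * E"
    using zero_le_power2[of "norm y - 1"] y2 by (simp add: power2_diff)
  have "E \<ge> 0" unfolding E_def by (rule lyap_nonneg[OF small(1)])
  have coef: "k0 * (lam r * norm (x' r)) + norm y \<le> k1 * (1 + E)"
  proof -
    have "k0 * (lam r * norm (x' r)) \<le> k0 * (1 + E)"
      using \<open>lam r * norm (x' r) \<le> 1 / 2 + E\<close> k0_pos by (intro mult_left_mono) auto
    moreover have "norm y \<le> (1 + 2 / c) * (1 + E)"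
    proof -
      have "0 \<le> 2 / c" using c_pos by simp
      moreover have "(1 + 2 / c) * (1 + E) = 1 + E + 2 / c + 2 / c * E"
        by (simp add: algebra_simps add_divide_distrib)
      ultimately show ?thesis using y1 \<open>E \<ge> 0\<close> by linarith
    qed
    ultimately show ?thesis unfolding k1_def by (simp add: algebra_simps)
  qed
  have forcing: "k0 * ((lam r)\<^sup>2 * inner (x' r) \<eta>) + lam r * inner \<eta> y \<le> k1 * (1 + E) * s"
  proof -
    have "inner (x' r) \<eta> \<le> norm (x' r) * norm \<eta>" "inner \<eta> y \<le> norm \<eta> * norm y"
      by (rule norm_cauchy_schwarz)+
    then have "k0 * ((lam r)\<^sup>2 * inner (x' r) \<eta>) + lam r * inner \<eta> y
      \<le> k0 * ((lam r)\<^sup>2 * (norm (x' r) * norm \<eta>)) + lam r * (norm \<eta> * norm y)"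
      using k0_pos lam by (intro add_mono mult_left_mono) auto
    also have "\<dots> = (k0 * (lam r * norm (x' r)) + norm y) * (lam r * norm \<eta>)"
      by (simp add: algebra_simps power2_eq_square)
    also have "\<dots> \<le> (k1 * (1 + E)) * s"
      using coef s k1_pos \<open>E \<ge> 0\<close> lam by (intro mult_mono) auto
    finally show ?thesis .
  qed
  \<comment> \<open>As \<open>lam''\<close> is nonpositive, this term increases \<open>lyap\<close>;
    the squared distance is bounded by \<open>E\<close>, so the increase also has the form of a
    growth rate.\<close>
  have curvature: "lam'' r * \<tau> * (k1 * (1 + E)) \<le> lam'' r * \<tau> * ((norm y)\<^sup>2 / 2)"
  proof (rule mult_left_mono_neg)
    have "2 / c * E \<le> k1 * (1 + E)"
      using k0_pos c_pos \<open>E \<ge> 0\<close> by (intro mult_mono) (auto simp: k1_def)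
    then show "(norm y)\<^sup>2 / 2 \<le> k1 * (1 + E)" using y2 by linarith
    show "lam'' r * \<tau> \<le> 0"
      using lam''_nonpos[OF \<open>r > 0\<close>] \<open>0 \<le> \<tau>\<close> by (simp add: mult_nonpos_nonneg)
  qed
  \<comment> \<open>Convexity replaces \<open>- lam * G\<close> by
    \<open>- lam * W + lam * A / 2\<close>. The kinetic total \<open>3 / 2 * lam * A\<close> is
    beaten by friction, as \<open>k0 * c \<ge> 4\<close>, and the smallness of
    \<open>k0 * lam'\<close> costs at most half of \<open>lam * W\<close>.\<close>
  have dissipation: "2 * k0 * lam r * lam' r * W r - k0 * c * lam r * A + lam r * A - lam r * G
      \<le> - (lam r * W r / 2)"
  proof -
    have "k0 * lam' r * (2 * lam r * W r) \<le> 1 / 4 * (2 * lam r * W r)"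
      using small lam energy_nonneg by (intro mult_right_mono) auto
    moreover have "lam r * (W r - A / 2) \<le> lam r * G"
      using G lam by (intro mult_left_mono) auto
    moreover have "3 / 2 * (lam r * A) \<le> (k0 * c) * (lam r * A)"
      using lam c_pos by (intro mult_right_mono) (auto simp: k0_def A_def algebra_simps)
    ultimately show ?thesis by (simp add: algebra_simps)
  qed
  let ?L = "k0 * (2 * lam r * lam' r * fst (\<tau>, \<eta> - \<tau> *\<^sub>R drift r, s) * energy r (x' r)
           + (lam r)\<^sup>2 * (inner (x' r) (fst (snd (\<tau>, \<eta> - \<tau> *\<^sub>R drift r, s)))
               + fst (\<tau>, \<eta> - \<tau> *\<^sub>R drift r, s) * inner (gradPhi (x r)) (x' r)))
       + (fst (\<tau>, \<eta> - \<tau> *\<^sub>R drift r, s) * lam' r * inner (x' r) (x r - v)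
           + lam r * (inner (fst (snd (\<tau>, \<eta> - \<tau> *\<^sub>R drift r, s))) (x r - v)
               + fst (\<tau>, \<eta> - \<tau> *\<^sub>R drift r, s) * inner (x' r) (x' r)))
       + ((c - lam' r) * (fst (\<tau>, \<eta> - \<tau> *\<^sub>R drift r, s) * inner (x r - v) (x' r))
           - fst (\<tau>, \<eta> - \<tau> *\<^sub>R drift r, s) * lam'' r * (inner (x r - v) (x r - v) / 2))"
  \<comment> \<open>A polynomial identity in real variables, in which the inner products with
    \<open>x - v\<close> and velocity cancel. Its two premises are the drift and friction terms
    cleared of the division by \<open>lam\<close>.\<close>
  have regroup: "k * (2 * l * l' * \<tau> * w + l\<^sup>2 * (i - q)) + (\<tau> * l' * p + l * (j - \<tau> * D + \<tau> * A))
      + ((c - l') * (\<tau> * p) - \<tau> * l'' * (n / 2))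
    = \<tau> * (2 * k * l * l' * w - k * c * l * A + l * A - l * G) + (k * (l\<^sup>2 * i) + l * j)
      - l'' * \<tau> * (n / 2)"
    if "l * D = c * p + l * G" "l\<^sup>2 * q = c * l * (\<tau> * A)" for k l l' l'' w i q p j D n :: real
  proof -
    have "l * (\<tau> * D) = \<tau> * (c * p + l * G)" "k * (l\<^sup>2 * q) = k * (c * l * (\<tau> * A))"
      using that by (simp_all add: mult.left_commute)
    then show ?thesis by (auto simp: algebra_simps)
  qed
  have "lam r * inner (drift r) y = c * inner (x' r) y + lam r * G"
    using lam by (simp add: drift_def G_def inner_add_left distrib_left)
  moreover have "(lam r)\<^sup>2 * (c / lam r * (\<tau> * A)) = c * lam r * (\<tau> * A)"
    using lam by (simp add: power2_eq_square)
  ultimately have "?L = \<tau> * (2 * k0 * lam r * lam' r * W r - k0 * c * lam r * A + lam r * A - lam r * G)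
      + (k0 * ((lam r)\<^sup>2 * inner (x' r) \<eta>) + lam r * inner \<eta> y) - (lam'' r * \<tau>) * ((norm y)\<^sup>2 / 2)"
    unfolding fst_conv snd_conv energy_derivative_cone y_def[symmetric] A_def[symmetric]
      power2_norm_eq_inner inner_diff_left[of \<eta>] inner_scaleR_left inner_commute[of y "x' r"]
    by (rule regroup)
  also have "\<dots> \<le> \<tau> * (- (lam r * W r / 2)) + k1 * (1 + E) * s - lam'' r * \<tau> * (k1 * (1 + E))"
    by (intro diff_mono add_mono mult_left_mono dissipation \<open>0 \<le> \<tau>\<close> forcing curvature)
  also have "\<dots> = - (\<tau> * (lam r * W r) / 2) + k1 * (1 + E) * (s - lam'' r * \<tau>)"
    by (simp add: algebra_simps)
  finally show "?L \<le> - (\<tau> * (lam r * W r) / 2) + k1 * (1 + lyap v r (x' r)) * (s - lam'' r * \<tau>)"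
    by (simp only: E_def)
qed

subsection \<open>Boundedness and limits\<close>

lemma I_fst_has_derivative:
  "r > 0 \<Longrightarrow> ((\<lambda>z. I (fst z)) has_derivative (\<lambda>h. fst h * (lam r * W r))) (at (r, p, q))"
  using has_derivative_fst_comp_real[of I "lam r * W r" "(r, p, q)"] I_deriv by simp

text \<open>Along the flow this is \<open>N - lam'\<close>, the accumulated Gronwall rate
  \<open>lam * norm g - lam''\<close>. It stays bounded because \<open>N\<close> and
  \<open>lam'\<close> do.\<close>

definition clock :: "real \<times> 'a \<times> real \<Rightarrow> real" where
  "clock z = snd (snd z) - lam' (fst z)"

lemma clock_has_derivative:
  assumes "r > 0"
  shows "(clock has_derivative (\<lambda>h. snd (snd h) - fst h * lam'' r)) (at (r, p, q))"
proof -
  have "((\<lambda>z. lam' (fst z)) has_derivative (\<lambda>h. fst h * lam'' r)) (at (r, p, q))"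
    using lam'_deriv assms by (intro has_derivative_fst_comp_real) auto
  then show ?thesis
    unfolding clock_def by (auto intro!: derivative_eq_intros)
qed

lemma clock_increment_nonneg:
  assumes "r > 0" "0 \<le> \<tau>" "lam r * norm (\<eta> :: 'a) \<le> s"
  shows "0 \<le> s - lam'' r * \<tau>"
proof -
  have "0 \<le> lam r * norm \<eta>" using lam_ge_1[of r] assms by simp
  moreover have "lam'' r * \<tau> \<le> 0"
    using lam''_nonpos assms by (simp add: mult_nonpos_nonneg)
  ultimately show ?thesis using assms by linarith
qed

lemma eventually_small: "\<exists>T>0. \<forall>t\<ge>T. lam' t \<le> c / 4 \<and> k0 * lam' t \<le> 1 / 4"
proof -
  have "0 < min (c / 4) (1 / (4 * k0))" using c_pos k0_pos by simp
  then obtain T where T: "\<And>t. t \<ge> T \<Longrightarrow> lam' t < min (c / 4) (1 / (4 * k0))"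
    using order_tendstoD(2)[OF lam'_tendsto_0] unfolding eventually_at_top_linorder by blast
  have "lam' t \<le> c / 4 \<and> k0 * lam' t \<le> 1 / 4" if "t \<ge> max T 1" for t
  proof -
    have "lam' t < c / 4" "lam' t < 1 / (4 * k0)" using T[of t] that by auto
    then show ?thesis using k0_pos by (simp add: field_simps)
  qed
  then show ?thesis by (intro exI[of _ "max T 1"]) auto
qed

definition T0 :: real where
  "T0 = (SOME T. T > 0 \<and> (\<forall>t\<ge>T. lam' t \<le> c / 4 \<and> k0 * lam' t \<le> 1 / 4))"

lemma T0_pos: "T0 > 0"
  and small: "T0 \<le> t \<Longrightarrow> lam' t \<le> c / 4" "T0 \<le> t \<Longrightarrow> k0 * lam' t \<le> 1 / 4"
  using someI_ex[OF eventually_small] unfolding T0_def by blast+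

lemma N_bounds: obtains B where "0 \<le> B" "\<And>t. 0 \<le> t \<Longrightarrow> \<bar>N t\<bar> \<le> B"
proof -
  obtain B where B: "\<And>t. 0 \<le> t \<Longrightarrow> \<bar>N t\<bar> \<le> B"
    using N_bounded by (auto simp: bounded_iff)
  moreover have "0 \<le> B" using B[of 0] by simp
  ultimately show thesis using that by blast
qed

text \<open>Gronwall's argument with the integrating factor \<open>exp (- k1 * clock)\<close>: its
  product with \<open>1 + lyap\<close> decreases, and \<open>clock\<close> is bounded above by the
  bound on \<open>N\<close>, as \<open>lam'\<close> is nonnegative.\<close>

lemma lyap_bounded:
  assumes v: "\<Phi> v = m"
  obtains M where "\<And>t. T0 \<le> t \<Longrightarrow> 1 + lyap v t (x' t) \<le> M"
proof -
  define \<psi> where "\<psi> z = (1 + lyap v (fst z) (fst (snd z))) * exp (- (k1 * clock z))" for z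
  have dec: "\<psi> (t, x' t, N t) \<le> \<psi> (T0, x' T0, N T0)" if "T0 \<le> t" for t
  proof (rule decreasing_along_flow[OF T0_pos that])
    fix r assume r: "T0 \<le> r" "r \<le> t"
    then have "r > 0" using T0_pos by simp
    define E where "E = lyap v r (x' r)"
    have "E \<ge> 0" unfolding E_def by (rule lyap_nonneg[OF small(1)[OF r(1)]])
    define e where "e = exp (- (k1 * clock (r, x' r, N r)))"
    have "e > 0" by (simp add: e_def)
    obtain L where L: "((\<lambda>z. lyap v (fst z) (fst (snd z))) has_derivative L) (at (r, x' r, N r))"
      and rate: "\<And>\<tau> \<eta> s. 0 \<le> \<tau> \<Longrightarrow> lam r * norm \<eta> \<le> s \<Longrightarrow>
        L (\<tau>, \<eta> - \<tau> *\<^sub>R drift r, s)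
          \<le> - (\<tau> * (lam r * W r) / 2) + k1 * (1 + lyap v r (x' r)) * (s - lam'' r * \<tau>)"
      by (rule lyap_rate[OF \<open>r > 0\<close> small[OF r(1)] v]) (rule that)
    note rate = rate[folded E_def]
    have "(\<psi> has_derivative (\<lambda>h. L h * e - (1 + E) * (e * (k1 * (snd (snd h) - fst h * lam'' r)))))
        (at (r, x' r, N r))"
      unfolding \<psi>_def E_def e_def
      by (auto intro!: derivative_eq_intros L clock_has_derivative[OF \<open>r > 0\<close>] simp: algebra_simps)
    moreover have "L (\<tau>, \<eta> - \<tau> *\<^sub>R drift r, s) * e - (1 + E) * (e * (k1 * (s - \<tau> * lam'' r))) \<le> 0"
      if "0 \<le> \<tau>" "lam r * norm \<eta> \<le> s" for \<tau> \<eta> s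
    proof -
      have "0 \<le> \<tau> * (lam r * W r) / 2"
        using that lam_W_nonneg[of r] \<open>r > 0\<close> by simp
      then have "L (\<tau>, \<eta> - \<tau> *\<^sub>R drift r, s) \<le> k1 * (1 + E) * (s - lam'' r * \<tau>)"
        using rate[OF that] by linarith
      then have "L (\<tau>, \<eta> - \<tau> *\<^sub>R drift r, s) * e \<le> k1 * (1 + E) * (s - lam'' r * \<tau>) * e"
        using \<open>e > 0\<close> by (intro mult_right_mono) auto
      then show ?thesis by (simp add: ac_simps)
    qed
    ultimately show "\<exists>L. (\<psi> has_derivative L) (at (r, x' r, N r)) \<and>
      (\<forall>\<tau> \<eta> s. 0 \<le> \<tau> \<longrightarrow> lam r * norm \<eta> \<le> s \<longrightarrow> L (\<tau>, \<eta> - \<tau> *\<^sub>R drift r, s) \<le> 0)"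
      by (intro exI conjI allI impI) auto
  qed
  obtain B where "0 \<le> B" and B: "\<And>t. 0 \<le> t \<Longrightarrow> \<bar>N t\<bar> \<le> B" by (rule N_bounds) (rule that)
  have "1 + lyap v t (x' t) \<le> \<psi> (T0, x' T0, N T0) * exp (k1 * B)" if "T0 \<le> t" for t
  proof -
    have "t > 0" using that T0_pos by simp
    have "1 + lyap v t (x' t) = \<psi> (t, x' t, N t) * exp (k1 * clock (t, x' t, N t))"
      by (simp add: \<psi>_def mult.assoc flip: exp_add)
    also have "\<dots> \<le> \<psi> (T0, x' T0, N T0) * exp (k1 * B)"
    proof (rule mult_mono[OF dec[OF that]])
      have "clock (t, x' t, N t) \<le> B"
        using B[of t] lam'_nonneg[of t] \<open>t > 0\<close> by (simp add: clock_def)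
      then show "exp (k1 * clock (t, x' t, N t)) \<le> exp (k1 * B)"
        using k1_pos by simp
      show "0 \<le> \<psi> (T0, x' T0, N T0)"
        using lyap_nonneg[OF small(1)[of T0], of v "x' T0"] by (simp add: \<psi>_def)
    qed simp
    finally show ?thesis .
  qed
  then show thesis using that by blast
qed

text \<open>With \<open>1 + lyap\<close> bounded by \<open>M\<close>, the growth term is at most
  \<open>k1 * M\<close> times the increment of \<open>clock\<close> and can be subtracted. The
  dissipation is now kept, as \<open>I / 2\<close>; this yields both the bound on \<open>I\<close>
  and the convergence of \<open>lyap\<close>.\<close>

lemma lyap_plus_I_decreasing:
  assumes v: "\<Phi> v = m" and M: "\<And>t. T0 \<le> t \<Longrightarrow> 1 + lyap v t (x' t) \<le> M"
    and "T0 \<le> a" "a \<le> b"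
  shows "lyap v b (x' b) + I b / 2 - k1 * M * (N b - lam' b)
      \<le> lyap v a (x' a) + I a / 2 - k1 * M * (N a - lam' a)"
proof -
  define \<psi> where "\<psi> z = lyap v (fst z) (fst (snd z)) + I (fst z) / 2 - k1 * M * clock z" for z
  have "a > 0" using T0_pos \<open>T0 \<le> a\<close> by simp
  have "\<psi> (b, x' b, N b) \<le> \<psi> (a, x' a, N a)"
  proof (rule decreasing_along_flow[OF \<open>a > 0\<close> \<open>a \<le> b\<close>])
    fix r assume r: "a \<le> r" "r \<le> b"
    then have "r > 0" "T0 \<le> r" using \<open>a > 0\<close> \<open>T0 \<le> a\<close> by simp_all
    define E where "E = lyap v r (x' r)"
    obtain L where L: "((\<lambda>z. lyap v (fst z) (fst (snd z))) has_derivative L) (at (r, x' r, N r))"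
      and rate: "\<And>\<tau> \<eta> s. 0 \<le> \<tau> \<Longrightarrow> lam r * norm \<eta> \<le> s \<Longrightarrow>
        L (\<tau>, \<eta> - \<tau> *\<^sub>R drift r, s)
          \<le> - (\<tau> * (lam r * W r) / 2) + k1 * (1 + lyap v r (x' r)) * (s - lam'' r * \<tau>)"
      by (rule lyap_rate[OF \<open>r > 0\<close> small[OF \<open>T0 \<le> r\<close>] v]) (rule that)
    note rate = rate[folded E_def]
    have "(\<psi> has_derivative (\<lambda>h. L h + fst h * (lam r * W r) / 2
        - k1 * M * (snd (snd h) - fst h * lam'' r))) (at (r, x' r, N r))"
      unfolding \<psi>_def
      by (auto intro!: derivative_eq_intros L clock_has_derivative[OF \<open>r > 0\<close>]
          I_fst_has_derivative[OF \<open>r > 0\<close>])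
    moreover have "L (\<tau>, \<eta> - \<tau> *\<^sub>R drift r, s) + \<tau> * (lam r * W r) / 2
        - k1 * M * (s - \<tau> * lam'' r) \<le> 0"
      if "0 \<le> \<tau>" "lam r * norm \<eta> \<le> s" for \<tau> \<eta> s
    proof -
      have "k1 * (1 + E) * (s - lam'' r * \<tau>) \<le> k1 * M * (s - lam'' r * \<tau>)"
        using clock_increment_nonneg[OF \<open>r > 0\<close> that] M[OF \<open>T0 \<le> r\<close>] k1_pos
        by (intro mult_right_mono mult_left_mono) (auto simp: E_def)
      then show ?thesis
        using rate[OF that] by (simp add: mult.commute[of \<tau> "lam'' r"])
    qed
    ultimately show "\<exists>L. (\<psi> has_derivative L) (at (r, x' r, N r)) \<and>
      (\<forall>\<tau> \<eta> s. 0 \<le> \<tau> \<longrightarrow> lam r * norm \<eta> \<le> s \<longrightarrow> L (\<tau>, \<eta> - \<tau> *\<^sub>R drift r, s) \<le> 0)"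
      by (intro exI conjI allI impI) auto
  qed
  then show ?thesis by (simp add: \<psi>_def clock_def)
qed

lemma clock_tendsto: "\<exists>l. ((\<lambda>t. N t - lam' t) \<longlongrightarrow> l) at_top"
proof -
  obtain B where B: "\<And>t. 0 \<le> t \<Longrightarrow> \<bar>N t\<bar> \<le> B" by (rule N_bounds) (rule that)
  have "\<exists>l. ((\<lambda>t. - N t) \<longlongrightarrow> l) at_top"
    by (rule tendsto_at_top_if_decreasing[of 0 _ "- B"])
      (use N_mono B in \<open>auto simp: abs_le_iff\<close>)
  then obtain l where "((\<lambda>t. - N t) \<longlongrightarrow> l) at_top" ..
  from tendsto_diff[OF tendsto_minus[OF this] lam'_tendsto_0] show ?thesis by auto
qed

lemma I_bounded:
  assumes v: "\<Phi> v = m"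
  obtains B where "\<And>t. I t \<le> B"
proof -
  obtain M where M: "\<And>t. T0 \<le> t \<Longrightarrow> 1 + lyap v t (x' t) \<le> M" by (rule lyap_bounded[OF v]) (rule that)
  obtain B where B: "\<And>t. 0 \<le> t \<Longrightarrow> \<bar>N t\<bar> \<le> B" by (rule N_bounds) (rule that)
  have "M \<ge> 0" using M[of T0] lyap_nonneg[OF small(1)[of T0], of v "x' T0"] by simp
  define R where "R = lyap v T0 (x' T0) + I T0 / 2 - k1 * M * (N T0 - lam' T0)"
  have late_arith: "i \<le> 2 * (R + b)" if "a \<le> b" "l + i / 2 - a \<le> R" "0 \<le> l" for a b i l :: real
    using that by simp
  have late: "I t \<le> 2 * (R + k1 * M * B)" if "T0 \<le> t" for t
  proof -
    have "t > 0" using that T0_pos by simp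
    have "N t - lam' t \<le> B" using B[of t] lam'_nonneg[of t] \<open>t > 0\<close> by simp
    then have "k1 * M * (N t - lam' t) \<le> k1 * M * B"
      using k1_pos \<open>M \<ge> 0\<close> by (intro mult_left_mono) auto
    moreover have "lyap v t (x' t) + I t / 2 - k1 * M * (N t - lam' t) \<le> R"
      unfolding R_def by (rule lyap_plus_I_decreasing[OF v M order_refl that])
    moreover have "0 \<le> lyap v t (x' t)"
      by (rule lyap_nonneg[OF small(1)[OF that]])
    ultimately show ?thesis
      using late_arith by blast
  qed
  have "I t \<le> 2 * (R + k1 * M * B)" for t
    using late[of "max t T0"] I_mono[of t "max t T0"] by simp
  then show thesis using that by blast
qed

lemma weighted_energy_bounded:
  assumes v: "\<Phi> v = m"
  obtains B where "0 \<le> B" "\<And>t. T0 \<le> t \<Longrightarrow> (lam t)\<^sup>2 * W t \<le> B"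
    "\<And>t. T0 \<le> t \<Longrightarrow> (norm (x t - v))\<^sup>2 \<le> B"
proof -
  obtain M where M: "\<And>t. T0 \<le> t \<Longrightarrow> 1 + lyap v t (x' t) \<le> M" by (rule lyap_bounded[OF v]) (rule that)
  have le: "(lam t)\<^sup>2 * W t + c / 4 * (norm (x t - v))\<^sup>2 \<le> M" if "T0 \<le> t" for t
    using lyap_lower[OF small(1)[OF that], of "x' t" v] M[OF that] by linarith
  have "M \<ge> 0" using M[of T0] lyap_nonneg[OF small(1)[of T0], of v "x' T0"] by simp
  have e: "0 \<le> (lam t)\<^sup>2 * W t" "0 \<le> c / 4 * (norm (x t - v))\<^sup>2" for t
    using energy_nonneg c_pos by auto
  show thesis
  proof (rule that)
    show "0 \<le> max M (4 / c * M)" using \<open>M \<ge> 0\<close> by simp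
    fix t assume t: "T0 \<le> t"
    show "(lam t)\<^sup>2 * W t \<le> max M (4 / c * M)" using le[OF t] e(2)[of t] by linarith
    have "c / 4 * (norm (x t - v))\<^sup>2 \<le> M" using le[OF t] e(1)[of t] by linarith
    then have "(norm (x t - v))\<^sup>2 \<le> 4 / c * M" using c_pos by (simp add: field_simps)
    then show "(norm (x t - v))\<^sup>2 \<le> max M (4 / c * M)" by linarith
  qed
qed

text \<open>Growth of the weight contributes \<open>2 * lam * lam' * W\<close>, which
  \<open>2 * I\<close> compensates because \<open>lam' \<le> 1\<close>. The forcing contributes at
  most \<open>(lam * norm x') * s\<close>, where the bounded weighted energy gives
  \<open>lam * norm x' \<le> 1 + B\<close>; friction only helps.\<close>

lemma weighted_energy_minus_I_decreasing:
  assumes B: "\<And>t. T0 \<le> t \<Longrightarrow> (lam t)\<^sup>2 * W t \<le> B" and "T0 \<le> a" "a \<le> b"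
  shows "(lam b)\<^sup>2 * W b - 2 * I b - (1 + B) * N b \<le> (lam a)\<^sup>2 * W a - 2 * I a - (1 + B) * N a"
proof -
  define \<psi> where "\<psi> z = (lam (fst z))\<^sup>2 * energy (fst z) (fst (snd z)) - 2 * I (fst z)
    - (1 + B) * snd (snd z)" for z
  have "a > 0" using T0_pos \<open>T0 \<le> a\<close> by simp
  have "\<psi> (b, x' b, N b) \<le> \<psi> (a, x' a, N a)"
  proof (rule decreasing_along_flow[OF \<open>a > 0\<close> \<open>a \<le> b\<close>])
    fix r assume r: "a \<le> r" "r \<le> b"
    then have "r > 0" "T0 \<le> r" using \<open>a > 0\<close> \<open>T0 \<le> a\<close> by simp_all
    have lam: "lam r \<ge> 1" using lam_ge_1 \<open>r > 0\<close> by simp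
    let ?z = "(r, x' r, N r)"
    have lam_d: "((\<lambda>z. lam (fst z)) has_derivative (\<lambda>h. fst h * lam' r)) (at ?z)"
      using lam_deriv \<open>r > 0\<close> by (intro has_derivative_fst_comp_real) auto
    have "(\<psi> has_derivative (\<lambda>h. 2 * lam r * lam' r * fst h * W r
        + (lam r)\<^sup>2 * (inner (x' r) (fst (snd h)) + fst h * inner (gradPhi (x r)) (x' r))
        - 2 * (fst h * (lam r * W r)) - (1 + B) * snd (snd h))) (at ?z)"
      unfolding \<psi>_def
      by (auto intro!: derivative_eq_intros lam_d energy_has_derivative[OF \<open>r > 0\<close>]
          I_fst_has_derivative[OF \<open>r > 0\<close>])
    moreover have "2 * lam r * lam' r * \<tau> * W r
        + (lam r)\<^sup>2 * (inner (x' r) (\<eta> - \<tau> *\<^sub>R drift r) + \<tau> * inner (gradPhi (x r)) (x' r))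
        - 2 * (\<tau> * (lam r * W r)) - (1 + B) * s \<le> 0"
      if \<tau>: "0 \<le> \<tau>" and s: "lam r * norm \<eta> \<le> s" for \<tau> \<eta> s
    proof -
      have "lam' r * (2 * (\<tau> * (lam r * W r))) \<le> 1 * (2 * (\<tau> * (lam r * W r)))"
        using lam'_le_1[OF \<open>r > 0\<close>] \<tau> lam energy_nonneg by (intro mult_right_mono) auto
      moreover have "(lam r)\<^sup>2 * (inner (x' r) \<eta> - c / lam r * (\<tau> * inner (x' r) (x' r))) \<le> (1 + B) * s"
      proof -
        have nn: "0 \<le> c / lam r * (\<tau> * inner (x' r) (x' r))"
          using c_pos lam \<tau> by simp
        have "lam r * norm (x' r) \<le> 1 / 2 + (lam r * norm (x' r))\<^sup>2 / 2"
          using zero_le_power2[of "lam r * norm (x' r) - 1"] by (simp add: power2_diff)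
        also have "(lam r * norm (x' r))\<^sup>2 / 2 \<le> (lam r)\<^sup>2 * W r"
          using mult_left_mono[OF half_norm_le_energy[of "x' r" r], of "(lam r)\<^sup>2"]
          by (simp add: power_mult_distrib)
        also have "\<dots> \<le> B" by (rule B[OF \<open>T0 \<le> r\<close>])
        finally have 1: "lam r * norm (x' r) \<le> 1 + B" by simp
        have "(lam r)\<^sup>2 * (inner (x' r) \<eta> - c / lam r * (\<tau> * inner (x' r) (x' r)))
            \<le> (lam r)\<^sup>2 * (norm (x' r) * norm \<eta>)"
          using norm_cauchy_schwarz[of "x' r" \<eta>] nn by (intro mult_left_mono) auto
        also have "\<dots> = (lam r * norm (x' r)) * (lam r * norm \<eta>)"
          by (simp add: power2_eq_square)
        also have "\<dots> \<le> (1 + B) * s"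
          using 1 s lam by (intro mult_mono) (auto intro: order_trans[OF _ 1])
        finally show ?thesis .
      qed
      ultimately show ?thesis
        unfolding energy_derivative_cone by (simp add: algebra_simps)
    qed
    ultimately show "\<exists>L. (\<psi> has_derivative L) (at (r, x' r, N r)) \<and>
      (\<forall>\<tau> \<eta> s. 0 \<le> \<tau> \<longrightarrow> lam r * norm \<eta> \<le> s \<longrightarrow> L (\<tau>, \<eta> - \<tau> *\<^sub>R drift r, s) \<le> 0)"
      by (intro exI conjI allI impI) auto
  qed
  then show ?thesis by (simp add: \<psi>_def)
qed

lemma I_tendsto:
  assumes v: "\<Phi> v = m"
  shows "\<exists>l. (I \<longlongrightarrow> l) at_top"
proof -
  obtain B where B: "\<And>t. I t \<le> B" by (rule I_bounded[OF v]) (rule that)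
  have "\<exists>l. ((\<lambda>t. - I t) \<longlongrightarrow> l) at_top"
    by (rule tendsto_at_top_if_decreasing[of 0 _ "- B"]) (use I_mono B in auto)
  then obtain l where "((\<lambda>t. - I t) \<longlongrightarrow> l) at_top" ..
  from tendsto_minus[OF this] show ?thesis by auto
qed

text \<open>The limit exists by monotonicity; it vanishes because \<open>lam * W\<close> is integrable while
  \<open>1 / lam\<close> is not.\<close>

lemma weighted_energy_tendsto_0:
  assumes v: "\<Phi> v = m"
  shows "((\<lambda>t. (lam t)\<^sup>2 * W t) \<longlongrightarrow> 0) at_top"
proof -
  obtain B where "0 \<le> B" and B: "\<And>t. T0 \<le> t \<Longrightarrow> (lam t)\<^sup>2 * W t \<le> B"
    by (rule weighted_energy_bounded[OF v]) (rule that)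
  obtain Bi where Bi: "\<And>t. I t \<le> Bi" by (rule I_bounded[OF v]) (rule that)
  obtain Bn where Bn: "\<And>t. 0 \<le> t \<Longrightarrow> \<bar>N t\<bar> \<le> Bn" by (rule N_bounds) (rule that)
  define F where "F t = (lam t)\<^sup>2 * W t - 2 * I t - (1 + B) * N t" for t
  \<comment> \<open>\<open>F\<close> is decreasing and bounded below; adding back the convergent
    \<open>I\<close> and \<open>N\<close> gives a limit of the weighted energy.\<close>
  have "\<exists>l. (F \<longlongrightarrow> l) at_top"
  proof (rule tendsto_at_top_if_decreasing)
    show "F t \<le> F s" if "T0 \<le> s" "s \<le> t" for s t
      unfolding F_def using weighted_energy_minus_I_decreasing[OF B that] by simp
    show "- 2 * Bi - (1 + B) * Bn \<le> F t" if "T0 \<le> t" for t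
    proof -
      have "0 \<le> (lam t)\<^sup>2 * W t" using energy_nonneg by simp
      moreover have "(1 + B) * N t \<le> (1 + B) * Bn"
        using Bn[of t] that T0_pos \<open>0 \<le> B\<close> by (intro mult_left_mono) (auto simp: abs_le_iff)
      ultimately show ?thesis using Bi[of t] unfolding F_def by linarith
    qed
  qed
  then obtain f where f: "(F \<longlongrightarrow> f) at_top" ..
  obtain i where i: "(I \<longlongrightarrow> i) at_top" using I_tendsto[OF v] ..
  obtain n where "((\<lambda>t. N t - lam' t) \<longlongrightarrow> n) at_top" using clock_tendsto ..
  from tendsto_add[OF this lam'_tendsto_0] have n: "(N \<longlongrightarrow> n) at_top" by simp
  define l where "l = f + 2 * i + (1 + B) * n"
  have "((\<lambda>t. F t + 2 * I t + (1 + B) * N t) \<longlongrightarrow> l) at_top"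
    unfolding l_def by (intro tendsto_intros f i n)
  then have l: "((\<lambda>t. (lam t)\<^sup>2 * W t) \<longlongrightarrow> l) at_top" by (simp add: F_def)
  have "l \<ge> 0"
    by (rule tendsto_lowerbound[OF l]) (simp_all add: energy_nonneg)
  moreover have False if "l > 0"
  proof -
    obtain T where T: "\<And>t. t \<ge> T \<Longrightarrow> l / 2 < (lam t)\<^sup>2 * W t"
      using order_tendstoD(1)[OF l, of "l / 2"] \<open>l > 0\<close> by (auto simp: eventually_at_top_linorder)
    define a where "a = max T 1"
    \<comment> \<open>From \<open>lam \<le> 1 + r\<close> it follows that
      \<open>lam * W = lam^2 * W / lam\<close> is at least \<open>l / 2 * (1 / (1 + r))\<close>.
      Thus \<open>I\<close> grows at least like a multiple of \<open>ln (1 + t)\<close>,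
      contradicting its boundedness.\<close>
    have dec: "l / 2 * ln (1 + t) - I t \<le> l / 2 * ln (1 + a) - I a" if "t \<ge> a" for t
    proof (rule DERIV_nonpos_imp_nonincreasing[OF that])
      fix r assume r: "a \<le> r" "r \<le> t"
      then have "r > 0" by (simp add: a_def)
      have lam: "1 \<le> lam r" "lam r \<le> 1 + r" using lam_ge_1 lam_le \<open>r > 0\<close> by auto
      have "l / 2 * (1 / (1 + r)) \<le> l / 2 * (1 / lam r)"
        using \<open>l > 0\<close> lam by (intro mult_left_mono divide_left_mono) auto
      also have "\<dots> \<le> (lam r)\<^sup>2 * W r * (1 / lam r)"
        using T[of r] r lam by (intro mult_right_mono) (auto simp: a_def)
      also have "\<dots> = lam r * W r" using lam by (simp add: power2_eq_square)
      finally have "l / 2 * (1 / (1 + r)) - lam r * W r \<le> 0" by simp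
      moreover have "((\<lambda>t. l / 2 * ln (1 + t) - I t) has_real_derivative
          l / 2 * (1 / (1 + r)) - lam r * W r) (at r)"
        using \<open>r > 0\<close> by (auto intro!: derivative_eq_intros I_deriv simp: field_simps)
      ultimately show "\<exists>y. ((\<lambda>t. l / 2 * ln (1 + t) - I t) has_real_derivative y) (at r) \<and> y \<le> 0"
        by blast
    qed
    have "filterlim (\<lambda>t::real. ln (1 + t)) at_top at_top"
      by (rule filterlim_compose[OF ln_at_top
            filterlim_tendsto_add_at_top[OF tendsto_const filterlim_ident]])
    then have "\<forall>\<^sub>F t in at_top. (l / 2 * ln (1 + a) - I a + Bi + 1) / (l / 2) \<le> ln (1 + t)"
      by (simp add: filterlim_at_top)
    then obtain t where t: "t \<ge> a" "(l / 2 * ln (1 + a) - I a + Bi + 1) / (l / 2) \<le> ln (1 + t)"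
      using eventually_happens'[OF _ eventually_conj[OF eventually_ge_at_top]] by force
    have "l / 2 * ln (1 + a) - I a + Bi + 1 \<le> l / 2 * ln (1 + t)"
      using t(2) \<open>l > 0\<close> by (simp add: pos_divide_le_eq mult.commute)
    then show False using dec[OF t(1)] Bi[of t] by linarith
  qed
  ultimately have "l = 0" by fastforce
  then show ?thesis using l by simp
qed

text \<open>\<open>lyap\<close> converges, since it becomes monotone after adding convergent terms.
  Its energy part tends to 0, its cross term is at most
  \<open>sqrt (2 * (lam^2 * W)) * sqrt B\<close>, and \<open>lam'\<close> times the squared distance
  vanishes; only \<open>c / 2\<close> times the squared distance is left.\<close>

lemma norm_diff_tendsto:
  assumes v: "\<Phi> v = m"
  shows "\<exists>l. ((\<lambda>t. (norm (x t - v))\<^sup>2) \<longlongrightarrow> l) at_top"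
proof -
  obtain M where M: "\<And>t. T0 \<le> t \<Longrightarrow> 1 + lyap v t (x' t) \<le> M" by (rule lyap_bounded[OF v]) (rule that)
  have "M \<ge> 0" using M[of T0] lyap_nonneg[OF small(1)[of T0], of v "x' T0"] by simp
  obtain B where "0 \<le> B" and B: "\<And>t. T0 \<le> t \<Longrightarrow> (norm (x t - v))\<^sup>2 \<le> B"
    by (rule weighted_energy_bounded[OF v]) (rule that)
  obtain q where q: "((\<lambda>t. N t - lam' t) \<longlongrightarrow> q) at_top" using clock_tendsto ..
  obtain i where i: "(I \<longlongrightarrow> i) at_top" using I_tendsto[OF v] ..
  obtain Bn where Bn: "\<And>t. 0 \<le> t \<Longrightarrow> \<bar>N t\<bar> \<le> Bn" by (rule N_bounds) (rule that)
  define F where "F t = lyap v t (x' t) + I t / 2 - k1 * M * (N t - lam' t)" for t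
  have "\<exists>l. (F \<longlongrightarrow> l) at_top"
  proof (rule tendsto_at_top_if_decreasing)
    show "F t \<le> F s" if "T0 \<le> s" "s \<le> t" for s t
      unfolding F_def using lyap_plus_I_decreasing[OF v M that] by simp
    show "- (k1 * M * Bn) \<le> F t" if "T0 \<le> t" for t
    proof -
      have "t > 0" using that T0_pos by simp
      have "k1 * M * (N t - lam' t) \<le> k1 * M * Bn"
        using Bn[of t] lam'_nonneg[of t] \<open>t > 0\<close> k1_pos \<open>M \<ge> 0\<close> by (intro mult_left_mono) auto
      then show ?thesis
        unfolding F_def
        using lyap_nonneg[OF small(1)[OF that], of v "x' t"] I_nonneg[of t] by linarith
    qed
  qed
  then obtain f where f: "(F \<longlongrightarrow> f) at_top" ..
  note W0 = weighted_energy_tendsto_0[OF v]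
  have "((\<lambda>t. sqrt (2 * ((lam t)\<^sup>2 * W t)) * sqrt B) \<longlongrightarrow> sqrt (2 * 0) * sqrt B) at_top"
    by (intro tendsto_intros W0)
  then have bound0: "((\<lambda>t. sqrt (2 * ((lam t)\<^sup>2 * W t)) * sqrt B) \<longlongrightarrow> 0) at_top" by simp
  have cross: "((\<lambda>t. lam t * inner (x' t) (x t - v)) \<longlongrightarrow> 0) at_top"
  proof (rule Lim_null_comparison[OF _ bound0], rule eventually_at_top_linorderI)
    fix t assume t: "T0 \<le> t"
    have lam: "lam t \<ge> 1" using lam_ge_1 T0_pos t by simp
    have "lam t * norm (x' t) = sqrt ((lam t * norm (x' t))\<^sup>2)"
      using lam by simp
    also have "\<dots> \<le> sqrt (2 * ((lam t)\<^sup>2 * W t))"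
      using mult_left_mono[OF half_norm_le_energy[of "x' t" t], of "(lam t)\<^sup>2"]
      by (intro real_sqrt_le_mono) (simp add: power_mult_distrib)
    finally have 1: "lam t * norm (x' t) \<le> sqrt (2 * ((lam t)\<^sup>2 * W t))" .
    have 2: "norm (x t - v) \<le> sqrt B"
      using B[OF t] by (rule real_le_rsqrt)
    have "norm (lam t * inner (x' t) (x t - v)) \<le> lam t * (norm (x' t) * norm (x t - v))"
      using lam Cauchy_Schwarz_ineq2[of "x' t" "x t - v"] by (simp add: abs_mult)
    also have "\<dots> = (lam t * norm (x' t)) * norm (x t - v)" by simp
    also have "\<dots> \<le> sqrt (2 * ((lam t)\<^sup>2 * W t)) * sqrt B"
      using 1 2 lam energy_nonneg by (intro mult_mono) auto
    finally show "norm (lam t * inner (x' t) (x t - v)) \<le> sqrt (2 * ((lam t)\<^sup>2 * W t)) * sqrt B" .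
  qed
  have curv: "((\<lambda>t. lam' t * (norm (x t - v))\<^sup>2) \<longlongrightarrow> 0) at_top"
  proof (rule Lim_null_comparison[OF eventually_at_top_linorderI])
    fix t assume t: "T0 \<le> t"
    then have "0 \<le> lam' t" using lam'_nonneg T0_pos by simp
    then show "norm (lam' t * (norm (x t - v))\<^sup>2) \<le> lam' t * B"
      using B[OF t] by (simp add: abs_mult mult_left_mono)
  next
    show "((\<lambda>t. lam' t * B) \<longlongrightarrow> 0) at_top"
      using tendsto_mult_left_zero[OF lam'_tendsto_0] by simp
  qed
  \<comment> \<open>The definitions of \<open>F\<close> and \<open>lyap\<close> solved for the
    squared distance.\<close>
  have "((\<lambda>t. 2 / c * (F t - I t / 2 + k1 * M * (N t - lam' t) - k0 * ((lam t)\<^sup>2 * W t)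
      - lam t * inner (x' t) (x t - v) + lam' t * (norm (x t - v))\<^sup>2 / 2))
    \<longlongrightarrow> 2 / c * (f - i / 2 + k1 * M * q - k0 * 0 - 0 + 0 / 2)) at_top"
    by (intro tendsto_intros f i q W0 cross curv) auto
  moreover have "2 / c * (F t - I t / 2 + k1 * M * (N t - lam' t) - k0 * ((lam t)\<^sup>2 * W t)
      - lam t * inner (x' t) (x t - v) + lam' t * (norm (x t - v))\<^sup>2 / 2) = (norm (x t - v))\<^sup>2" for t
  proof -
    have "F t - I t / 2 + k1 * M * (N t - lam' t) - k0 * ((lam t)\<^sup>2 * W t)
        - lam t * inner (x' t) (x t - v) + lam' t * (norm (x t - v))\<^sup>2 / 2
      = c * (norm (x t - v))\<^sup>2 / 2"
      unfolding F_def lyap_def power2_norm_eq_inner[symmetric]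
      by (simp add: left_diff_distrib diff_divide_distrib)
    then show ?thesis by (simp only:) (use c_pos in simp)
  qed
  ultimately show ?thesis by auto
qed

section \<open>Weak convergence and integrability\<close>

text \<open>Each sublevel set at height \<open>m + e\<close> is closed and convex, and eventually
  contains \<open>x t\<close>, because \<open>\<Phi> (x t) - m \<le> W t \<le> lam^2 * W\<close> and
  the weighted energy tends to 0.\<close>

lemma tail_hull_subset_minimizers:
  assumes v: "\<Phi> v = m"
  shows "tail_hull x (\<lambda>_. True) \<subseteq> {y. \<Phi> y = m}"
proof
  fix y assume y: "y \<in> tail_hull x (\<lambda>_. True)"
  have "\<Phi> y \<le> m + e" if "e > 0" for e
  proof -
    have "continuous_on UNIV \<Phi>"
      using gradient by (auto simp: continuous_on_eq_continuous_within intro: has_derivative_continuous)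
    then have "closed {y. \<Phi> y \<le> m + e}"
      by (intro closed_Collect_le) auto
    moreover have "convex {y. \<Phi> y \<le> m + e}"
      unfolding convex_def
    proof (intro ballI allI impI CollectI)
      fix a b and s t :: real
      assume "a \<in> {y. \<Phi> y \<le> m + e}" "b \<in> {y. \<Phi> y \<le> m + e}" "0 \<le> s" "0 \<le> t" "s + t = 1"
      then show "\<Phi> (s *\<^sub>R a + t *\<^sub>R b) \<le> m + e"
        using convex_lower[OF convex, of a b s t] by fastforce
    qed
    moreover have "\<forall>\<^sub>F t in at_top. True \<longrightarrow> x t \<in> {y. \<Phi> y \<le> m + e}"
    proof -
      have "\<forall>\<^sub>F t in at_top. (lam t)\<^sup>2 * W t < e"
        using order_tendstoD(2)[OF weighted_energy_tendsto_0[OF v]] that by simp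
      then show ?thesis
        using eventually_ge_at_top[of 0]
      proof eventually_elim
        case (elim t)
        have "1 * W t \<le> (lam t)\<^sup>2 * W t"
          using lam_ge_1[OF elim(2)] energy_nonneg by (intro mult_right_mono) (auto simp: one_le_power)
        moreover have "\<Phi> (x t) - m \<le> W t" by (simp add: energy_def)
        ultimately show ?case using elim(1) by simp
      qed
    qed
    ultimately show ?thesis using tail_hull_subset[of _ "\<lambda>_. True" x] y by blast
  qed
  then have "\<Phi> y \<le> m" by (rule field_le_epsilon)
  then show "y \<in> {y. \<Phi> y = m}" using lower[of y] by simp
qed

lemma weak_convergence:
  assumes v: "\<Phi> v = m"
  shows "\<exists>xs. \<Phi> xs = m \<and> weak_conv_at_top x xs"
proof -
  obtain B where B: "\<And>t. T0 \<le> t \<Longrightarrow> (norm (x t - v))\<^sup>2 \<le> B"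
    by (rule weighted_energy_bounded[OF v]) (rule that)
  have bdd: "norm (x t) \<le> norm v + sqrt B" if "T0 \<le> t" for t
    using real_le_rsqrt[OF B[OF that]] norm_triangle_sub[of "x t" v] by linarith
  have "\<exists>xs\<in>{y. \<Phi> y = m}. weak_conv_at_top x xs"
    by (rule weak_conv_if_tail_hull_subset[OF bdd tail_hull_subset_minimizers[OF v]])
      (auto intro: norm_diff_tendsto)
  then show ?thesis by blast
qed

lemma weighted_energy_integrable:
  assumes v: "\<Phi> v = m"
  shows "(\<lambda>t. lam t * W t) integrable_on {0..}"
proof -
  obtain i where "(I \<longlongrightarrow> i) at_top" using I_tendsto[OF v] ..
  then have "((\<lambda>t. lam t * W t) has_integral i) {0..}"
    unfolding I_def using lam_W_nonneg by (intro has_integral_to_inf integrable_lam_W) auto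
  then show ?thesis by blast
qed

end

section \<open>Indefinite integrals in Hilbert spaces\<close>

lemma norm_blinfun_inner_right: "norm (blinfun_inner_right v) = norm v"
proof (rule antisym)
  show "norm (blinfun_inner_right v) \<le> norm v"
    by (rule norm_blinfun_bound) (auto simp: Cauchy_Schwarz_ineq2)
  have "norm v * norm v \<le> norm (blinfun_inner_right v) * norm v"
    using norm_blinfun[of "blinfun_inner_right v" v]
    by (simp add: power2_norm_eq_inner[symmetric] power2_eq_square)
  then show "norm v \<le> norm (blinfun_inner_right v)"
    by (cases "v = 0") (auto simp: mult_le_cancel_right)
qed

lemma continuous_on_atLeastI:
  assumes "\<And>T. continuous_on {a..T} f"
  shows "continuous_on {a::real..} f"
  unfolding continuous_on_eq_continuous_within
proof
  fix t assume "t \<in> {a..}"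
  then have "continuous (at t within {a..t + 1}) f"
    using assms[of "t + 1"] by (auto simp: continuous_on_eq_continuous_within)
  moreover have "at t within {a..t + 1} = at t within {a..}"
    by (rule at_within_nhd[of _ "{..<t + 1}"]) auto
  ultimately show "continuous (at t within {a..}) f" by simp
qed

text \<open>The sort \<open>{real_inner, complete_space}\<close> is not below \<open>banach\<close>, which the library requires of
  the values of indefinite integrals. The isometric embedding into the dual space, which is of
  class \<open>banach\<close>, makes that theory available.\<close>

context
  fixes h f :: "real \<Rightarrow> 'a::real_inner"
  assumes f: "\<And>t. t \<ge> 0 \<Longrightarrow> f integrable_on {0..t} \<and> h t = h 0 + integral {0..t} f"
begin

private abbreviation (input) J :: "'a \<Rightarrow> 'a \<Rightarrow>\<^sub>L real" where
  "J \<equiv> blinfun_inner_right"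

private lemma J: "bounded_linear J"
  by (rule bounded_linear_blinfun_inner_right)

private lemma J_f: "(J \<circ> f) integrable_on {0..t}"
proof (cases "t \<ge> 0")
  case True
  then show ?thesis using f integrable_linear[OF _ J] by blast
qed auto

private lemma J_h: "t \<ge> 0 \<Longrightarrow> J (h t) = J (h 0) + integral {0..t} (J \<circ> f)"
  using f[of t] integral_linear[OF _ J, of f "{0..t}"]
  by (simp add: linear_add[OF bounded_linear.linear[OF J]])

lemma continuous_on_indefinite_integral: "continuous_on {0..} h"
proof -
  have "continuous_on {0..} (\<lambda>t. J (h 0) + integral {0..t} (J \<circ> f))"
    by (intro continuous_intros continuous_on_atLeastI indefinite_integral_continuous_1 J_f)
  then have "continuous_on {0..} (\<lambda>t. J (h t))"
    by (rule continuous_on_eq) (rule J_h[symmetric], simp)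
  moreover have "dist (J (h s)) (J (h t)) = dist (h s) (h t)" for s t
    using norm_blinfun_inner_right[of "h s - h t"]
    by (simp add: dist_norm linear_diff[OF bounded_linear.linear[OF J]])
  ultimately show ?thesis by (simp add: continuous_on_iff)
qed

lemma norm_indefinite_integral_increment_le:
  assumes "0 \<le> u" "u \<le> v" and Z: "negligible Z"
    and le: "\<And>s. s \<in> {u..v} - Z \<Longrightarrow> norm (f s - w) \<le> b s"
    and b: "b integrable_on {u..v}"
  shows "norm (h v - h u - (v - u) *\<^sub>R w) \<le> integral {u..v} b"
proof -
  \<comment> \<open>Integrand and bound are both set to 0 on \<open>Z\<close>, so that the pointwise
    comparison holds everywhere while the integrals are unchanged.\<close>
  define k where "k s = (if s \<in> Z then 0 else J (f s - w))" for s
  have J_diff: "J (p - q) = J p - J q" for p q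
    by (rule linear_diff[OF bounded_linear.linear[OF J]])
  have "J (h v) - J (h u) = integral {u..v} (J \<circ> f)"
    using Henstock_Kurzweil_Integration.integral_combine[OF assms(1,2) J_f] J_h[of u] J_h[of v] assms(1,2)
    by (simp add: algebra_simps)
  moreover have Jf: "(J \<circ> f) integrable_on {u..v}"
    by (rule integrable_subinterval_real[OF J_f[of v]]) (use assms in auto)
  ultimately have hi: "((\<lambda>s. (J \<circ> f) s - J w) has_integral (J (h v) - J (h u) - (v - u) *\<^sub>R J w)) {u..v}"
    using has_integral_diff[OF integrable_integral[OF Jf] has_integral_const_real[of "J w" u v]] assms(2)
    by simp
  have "(k has_integral (J (h v) - J (h u) - (v - u) *\<^sub>R J w)) {u..v}"
    by (rule has_integral_spike[OF Z _ hi]) (auto simp: k_def J_diff)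
  moreover have "J (h v) - J (h u) - (v - u) *\<^sub>R J w = J (h v - h u - (v - u) *\<^sub>R w)"
    by (simp add: J_diff linear_scale[OF bounded_linear.linear[OF J]])
  ultimately have k: "(k has_integral J (h v - h u - (v - u) *\<^sub>R w)) {u..v}" by simp
  define b' where "b' s = (if s \<in> Z then 0 else b s)" for s
  have b': "(b' has_integral integral {u..v} b) {u..v}"
    by (rule has_integral_spike[OF Z _ integrable_integral[OF b]]) (auto simp: b'_def)
  have "norm (integral {u..v} k) \<le> integral {u..v} b'"
    by (rule integral_norm_bound_integral)
      (use k b' le in \<open>auto simp: k_def b'_def norm_blinfun_inner_right\<close>)
  then show ?thesis
    using k b' by (simp add: integral_unique norm_blinfun_inner_right)
qed

end

lemma weight_mult_integral_le:
  fixes lam n :: "real \<Rightarrow> real"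
  assumes "u \<le> v" and n: "n integrable_on {u..v}" "\<And>s. s \<in> {u..v} \<Longrightarrow> 0 \<le> n s"
    and lam_n: "(\<lambda>s. lam s * n s) integrable_on {u..v}"
    and mono: "\<And>s. s \<in> {u..v} \<Longrightarrow> lam u \<le> lam s"
  shows "lam u * integral {u..v} n \<le> integral {u..v} (\<lambda>s. lam s * n s)"
proof -
  have "integral {u..v} (\<lambda>s. lam u * n s) \<le> integral {u..v} (\<lambda>s. lam s * n s)"
    by (intro integral_le integrable_on_mult_right n lam_n mult_right_mono mono)
  then show ?thesis by simp
qed

section \<open>Application to the weight \<open>(1 + t) powr \<alpha>\<close>\<close>

theorem theorem1:
  fixes \<Phi> :: "'a::{real_inner, complete_space} \<Rightarrow> real"
    and gradPhi :: "'a \<Rightarrow> 'a"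
    and x x' x'' g :: "real \<Rightarrow> 'a"
    and c \<alpha> :: real
  assumes convex: "convex_on UNIV \<Phi>"
    and C1: "is_C1_gradient \<Phi> gradPhi"
    and argmin_ne: "argmin_set \<Phi> \<noteq> {}"
    and c_pos: "c > 0"
    and alpha: "0 \<le> \<alpha>" "\<alpha> < 1"
    and g_L1: "g integrable_on {0..}" "(\<lambda>t. norm (g t)) integrable_on {0..}"
    and x_deriv: "\<And>t. t \<ge> 0 \<Longrightarrow> (x has_vector_derivative x' t) (at t within {0..})"
    and x'_int: "\<And>t. t \<ge> 0 \<Longrightarrow> x'' integrable_on {0..t} \<and> x' t = x' 0 + integral {0..t} x''"
    and ode: "negligible {t \<in> {0..}.
               x'' t + (c / (1 + t) powr \<alpha>) *\<^sub>R x' t + gradPhi (x t) \<noteq> g t}"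
    and g_weighted: "(\<lambda>t. (1 + t) powr \<alpha> * norm (g t)) integrable_on {0..}"
  shows "(\<exists>xs \<in> argmin_set \<Phi>. weak_conv_at_top x xs)
    \<and> (\<lambda>t. 1/2 * (norm (x' t))\<^sup>2 + \<Phi> (x t) - (INF v. \<Phi> v))
           \<in> O[at_top](\<lambda>t. 1 / t powr (2 * \<alpha>))
    \<and> (\<lambda>t. (1 + t) powr \<alpha> * (1/2 * (norm (x' t))\<^sup>2 + \<Phi> (x t) - (INF v. \<Phi> v)))
           integrable_on {0..}"
proof -
  define m where "m = (INF v. \<Phi> v)"
  define lam where "lam t = (1 + t) powr \<alpha>" for t :: real
  define lam' where "lam' t = \<alpha> * (1 + t) powr (\<alpha> - 1)" for t :: real
  define lam'' where "lam'' t = \<alpha> * ((\<alpha> - 1) * (1 + t) powr (\<alpha> - 2))" for t :: real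
  define N where "N t = integral {0..t} (\<lambda>s. lam s * norm (g s))" for t
  define drift where "drift t = (c / lam t) *\<^sub>R x' t + gradPhi (x t)" for t
  obtain v where v_min: "\<And>y. \<Phi> v \<le> \<Phi> y" using argmin_ne by (auto simp: argmin_set_def)
  then have v: "\<Phi> v = m"
    unfolding m_def by (intro cInf_eq_minimum[symmetric]) auto
  have argmin: "y \<in> argmin_set \<Phi>" if "\<Phi> y = m" for y
    using that v v_min by (simp add: argmin_set_def)
  have gradient: "(\<Phi> has_derivative (\<lambda>h. inner (gradPhi y) h)) (at y)" for y
    using C1 by (simp add: is_C1_gradient_def)
  have n_int: "(\<lambda>s. norm (g s)) integrable_on {u..w}" if "0 \<le> u" for u w
    by (rule integrable_on_subinterval[OF g_L1(2)]) (use that in auto)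
  have ln_int: "(\<lambda>s. lam s * norm (g s)) integrable_on {u..w}" if "0 \<le> u" for u w
    by (rule integrable_on_subinterval[OF g_weighted[folded lam_def]]) (use that in auto)
  have cont_x: "continuous_on {0..} x"
    using x_deriv by (auto simp: continuous_on_eq_continuous_within intro: has_vector_derivative_continuous)
  have cont_x': "continuous_on {0..} x'"
    by (rule continuous_on_indefinite_integral[OF x'_int])
  have cont_lam: "continuous_on {0..} lam"
    unfolding lam_def by (intro continuous_intros) auto
  have lam_ge_1: "1 \<le> lam t" if "0 \<le> t" for t
    unfolding lam_def using that alpha by (intro ge_one_powr_ge_zero) auto
  have lam_mono: "lam s \<le> lam t" if "0 \<le> s" "s \<le> t" for s t
    unfolding lam_def using that alpha by (intro powr_mono2) auto
  have cont_drift: "continuous_on {0..} drift"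
  proof -
    have "continuous_on {0..} (\<lambda>t. gradPhi (x t))"
      using C1 continuous_on_compose2[OF _ cont_x] by (auto simp: is_C1_gradient_def)
    moreover have "\<forall>t\<in>{0..}. lam t \<noteq> 0" using lam_ge_1 by fastforce
    ultimately show ?thesis
      unfolding drift_def by (intro continuous_intros cont_lam cont_x') auto
  qed
  have N_diff: "N w - N u = integral {u..w} (\<lambda>s. lam s * norm (g s))" if "0 \<le> u" "u \<le> w" for u w
    unfolding N_def using Henstock_Kurzweil_Integration.integral_combine[OF that ln_int[of 0 w]] by simp
  have lam_n_nonneg: "0 \<le> lam s * norm (g s)" for s by (simp add: lam_def)
  have N_le: "N t \<le> integral {0..} (\<lambda>s. lam s * norm (g s))" for t
    unfolding N_def
    by (intro integral_subset_le ln_int g_weighted[folded lam_def]) (auto simp: lam_n_nonneg)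
  have N_nonneg: "0 \<le> N t" for t
    unfolding N_def by (intro integral_nonneg ln_int lam_n_nonneg) auto
  define Z where "Z = {t \<in> {0..}. x'' t + (c / (1 + t) powr \<alpha>) *\<^sub>R x' t + gradPhi (x t) \<noteq> g t}"
  have increment: "\<exists>d>0. \<forall>u w. u \<le> r \<and> r \<le> w \<and> w - u < d \<longrightarrow>
        lam r * norm (x' w - x' u + (w - u) *\<^sub>R drift r) \<le> (1 + e) * (N w - N u) + e * (w - u)"
    if "r > 0" "e > 0" for r e
  proof -
    have "lam r \<ge> 1" using lam_ge_1 \<open>r > 0\<close> by simp
    have "isCont lam r" "isCont drift r"
      using cont_lam cont_drift \<open>r > 0\<close> by (auto intro!: continuous_on_interior[of "{0..}"])
    \<comment> \<open>The second tolerance is chosen so that closeness to \<open>lam r\<close> means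
      \<open>lam s > lam r / (1 + e)\<close>, that is
      \<open>lam r < (1 + e) * lam s\<close>.\<close>
    moreover have "e / lam r > 0" "lam r - lam r / (1 + e) > 0"
      using \<open>e > 0\<close> \<open>lam r \<ge> 1\<close> by (auto simp: field_simps)
    ultimately obtain d1 d2 where "d1 > 0" "d2 > 0"
      and d1: "\<And>s. dist s r < d1 \<Longrightarrow> dist (lam s) (lam r) < lam r - lam r / (1 + e)"
      and d2: "\<And>s. dist s r < d2 \<Longrightarrow> dist (drift s) (drift r) < e / lam r"
      unfolding continuous_at_eps_delta by metis
    define d where "d = Min {d1, d2, r}"
    have d: "d > 0" "d \<le> d1" "d \<le> d2" "d \<le> r"
      using \<open>d1 > 0\<close> \<open>d2 > 0\<close> \<open>r > 0\<close> by (auto simp: d_def)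
    have "lam r * norm (x' w - x' u + (w - u) *\<^sub>R drift r) \<le> (1 + e) * (N w - N u) + e * (w - u)"
      if u: "u \<le> r" and w: "r \<le> w" and uw: "w - u < d" for u w
    proof -
      have "0 \<le> u" using u w uw d by linarith
      have "u \<le> w" using u w by linarith
      define b where "b s = norm (g s) + e / lam r" for s
      have b: "(b has_integral integral {u..w} (\<lambda>s. norm (g s)) + (w - u) * (e / lam r)) {u..w}"
        unfolding b_def
        using has_integral_add[OF integrable_integral[OF n_int[OF \<open>0 \<le> u\<close>]]
            has_integral_const_real[of "e / lam r" u w]] \<open>u \<le> w\<close> by simp
      have "norm (x' w - x' u - (w - u) *\<^sub>R (- drift r)) \<le> integral {u..w} b"
      proof (rule norm_indefinite_integral_increment_le[OF x'_int \<open>0 \<le> u\<close> \<open>u \<le> w\<close> ode[folded Z_def]])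
        fix s assume s: "s \<in> {u..w} - Z"
        then have "x'' s + drift s = g s"
          using \<open>0 \<le> u\<close> by (auto simp: Z_def drift_def lam_def add.assoc)
        then have eq: "x'' s - (- drift r) = g s - (drift s - drift r)"
          by (simp add: eq_diff_eq algebra_simps)
        have "norm (drift s - drift r) \<le> e / lam r"
          using d2[of s] s u w uw d by (auto simp: dist_norm abs_le_iff less_imp_le)
        then show "norm (x'' s - (- drift r)) \<le> b s"
          unfolding eq b_def using norm_triangle_ineq4[of "g s" "drift s - drift r"] by linarith
      qed (assumption, rule has_integral_integrable[OF b])
      also have "integral {u..w} b = integral {u..w} (\<lambda>s. norm (g s)) + (w - u) * (e / lam r)"
        using b by (rule integral_unique)
      finally have "lam r * norm (x' w - x' u + (w - u) *\<^sub>R drift r)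
          \<le> lam r * (integral {u..w} (\<lambda>s. norm (g s)) + (w - u) * (e / lam r))"
        using \<open>lam r \<ge> 1\<close> by (intro mult_left_mono) auto
      also have "\<dots> = lam r * integral {u..w} (\<lambda>s. norm (g s)) + e * (w - u)"
        using \<open>lam r \<ge> 1\<close> by (simp add: distrib_left)
      also have "lam r * integral {u..w} (\<lambda>s. norm (g s)) \<le> (1 + e) * (N w - N u)"
      proof -
        have "lam r / (1 + e) < lam u"
          using d1[of u] u w uw d by (auto simp: dist_real_def)
        then have "lam r \<le> (1 + e) * lam u"
          using \<open>e > 0\<close> by (simp add: field_simps)
        then have "lam r * integral {u..w} (\<lambda>s. norm (g s))
            \<le> (1 + e) * lam u * integral {u..w} (\<lambda>s. norm (g s))"
          by (intro mult_right_mono integral_nonneg n_int \<open>0 \<le> u\<close>) auto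
        also have "\<dots> \<le> (1 + e) * (N w - N u)"
          unfolding N_diff[OF \<open>0 \<le> u\<close> \<open>u \<le> w\<close>] mult.assoc
          using \<open>e > 0\<close> \<open>0 \<le> u\<close>
          by (intro mult_left_mono weight_mult_integral_le \<open>u \<le> w\<close> n_int ln_int lam_mono) auto
        finally show ?thesis .
      qed
      finally show ?thesis by simp
    qed
    then show ?thesis using \<open>d > 0\<close> by blast
  qed
  interpret F: damped_inertial_flow \<Phi> gradPhi x x' N lam lam' lam'' c m
  proof
    show "m \<le> \<Phi> y" for y using v v_min by metis
    show "(x has_vector_derivative x' t) (at t)" if "0 < t" for t
      using x_deriv[of t] that at_within_interior[of t "{0..}"] by simp
    show "\<exists>d>0. \<forall>u w. u \<le> r \<and> r \<le> w \<and> w - u < d \<longrightarrow>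
        lam r * norm (x' w - x' u + (w - u) *\<^sub>R ((c / lam r) *\<^sub>R x' r + gradPhi (x r)))
          \<le> (1 + e) * (N w - N u) + e * (w - u)" if "0 < r" "0 < e" for r e
      using increment[OF that] by (simp only: drift_def)
    show "continuous_on {0..} N"
      unfolding N_def
      by (intro continuous_on_atLeastI indefinite_integral_continuous_1 ln_int) simp
    show "N s \<le> N t" if "0 \<le> s" "s \<le> t" for s t
    proof -
      have "0 \<le> N t - N s"
        unfolding N_diff[OF that] by (intro integral_nonneg ln_int lam_n_nonneg that)
      then show ?thesis by simp
    qed
    show "bounded (N ` {0..})"
      using N_le N_nonneg by (intro boundedI) auto
    show "(lam has_real_derivative lam' t) (at t)" if "0 < t" for t
      unfolding lam_def lam'_def using that by (auto intro!: derivative_eq_intros)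
    show "(lam' has_real_derivative lam'' t) (at t)" if "0 < t" for t
      unfolding lam''_def lam'_def using that by (auto intro!: derivative_eq_intros)
    show "lam t \<le> 1 + t" if "0 \<le> t" for t
      using powr_mono[of \<alpha> 1 "1 + t"] that alpha by (simp add: lam_def)
    show "0 \<le> lam' t" if "0 < t" for t
      using alpha by (simp add: lam'_def)
    show "lam' t \<le> 1" if "0 < t" for t
    proof -
      have "(1 + t) powr (\<alpha> - 1) \<le> 1" using powr_mono[of "\<alpha> - 1" 0 "1 + t"] that alpha by simp
      then show ?thesis unfolding lam'_def using alpha by (intro mult_le_one) auto
    qed
    show "lam'' t \<le> 0" if "0 < t" for t
      using alpha by (simp add: lam''_def mult_nonneg_nonpos mult_nonpos_nonneg)
    show "(lam' \<longlongrightarrow> 0) at_top"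
    proof -
      have "((\<lambda>t. \<alpha> * (1 + t) powr (\<alpha> - 1)) \<longlongrightarrow> \<alpha> * 0) at_top"
        using alpha
        by (intro tendsto_intros tendsto_neg_powr filterlim_tendsto_add_at_top[OF tendsto_const]
            filterlim_ident) auto
      then show ?thesis by (simp add: lam'_def[abs_def])
    qed
  qed (use convex gradient c_pos cont_x cont_x' cont_lam lam_ge_1 in auto)
  have W: "1/2 * (norm (x' t))\<^sup>2 + \<Phi> (x t) - (INF v. \<Phi> v) = F.energy t (x' t)" for t
    unfolding m_def[symmetric] F.energy_def by (simp add: power2_norm_eq_inner)
  obtain B where B: "\<And>t. F.T0 \<le> t \<Longrightarrow> (lam t)\<^sup>2 * F.energy t (x' t) \<le> B"
    by (rule F.weighted_energy_bounded[OF v]) (rule that)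
  \<comment> \<open>The bound \<open>B\<close> on \<open>lam^2 * W\<close> serves as the constant,
    since \<open>t powr (2 * \<alpha>)\<close> is at most
    \<open>(1 + t) powr (2 * \<alpha>) = lam^2\<close>.\<close>
  have "(\<lambda>t. F.energy t (x' t)) \<in> O[at_top](\<lambda>t. 1 / t powr (2 * \<alpha>))"
  proof (rule bigoI[of _ B], rule eventually_at_top_linorderI)
    fix t assume t: "F.T0 \<le> t"
    then have "t > 0" using F.T0_pos by simp
    have "t powr (2 * \<alpha>) \<le> (1 + t) powr (2 * \<alpha>)"
      using \<open>t > 0\<close> alpha by (intro powr_mono2) auto
    also have "\<dots> = (lam t)\<^sup>2"
      by (simp add: lam_def power2_eq_square flip: powr_add)
    finally have "t powr (2 * \<alpha>) * F.energy t (x' t) \<le> (lam t)\<^sup>2 * F.energy t (x' t)"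
      using F.energy_nonneg by (intro mult_right_mono)
    then have "t powr (2 * \<alpha>) * F.energy t (x' t) \<le> B" using B[OF t] by linarith
    then show "norm (F.energy t (x' t)) \<le> B * norm (1 / t powr (2 * \<alpha>))"
      using \<open>t > 0\<close> F.energy_nonneg by (simp add: field_simps)
  qed
  moreover have "\<exists>xs\<in>argmin_set \<Phi>. weak_conv_at_top x xs"
    using F.weak_convergence[OF v] argmin by blast
  moreover have "(\<lambda>t. (1 + t) powr \<alpha> * F.energy t (x' t)) integrable_on {0..}"
    using F.weighted_energy_integrable[OF v] by (simp add: lam_def)
  ultimately show ?thesis unfolding W by (intro conjI)
qed

end
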